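(* Let $E_n \subseteq \mathbb{T}$ ($n\ge1$) be Lebesgue measurable. The following are equivalent: (a) $\sum_{n \geq 1} m(E_n) < \infty$; (b) $v = \pi \sum_{n \geq 1} \chi_{E_n} \in L^1(\mathbb{T},m)$; (c) $\prod_{n \geq 1} f_{E_n}$ converges absolutely and locally uniformly on $\mathbb{D}$. Moreover, the product in (c) belongs to $\mathsf{R}^{+}$ if and only if $v \in L\log L$.
   Context: $\mathbb{D}$ is the open unit disk, $\mathbb{T}$ the unit circle, $m$ normalized Lebesgue measure, $\chi_E$ the characteristic function of $E$. For measurable $E\subseteq\mathbb{T}$, $f_E(z) = \exp\big[i\pi\int_E \frac{\zeta+z}{\zeta-z}\,dm(\zeta)\big]$, $z\in\mathbb{D}$. A product of functions converges absolutely and locally uniformly if $\sum|1-w_n(z)|$ converges uniformly on compact subsets of $\mathbb{D}$. The Smirnov class is $N^+ = \{f/g : f,g \in H^\infty,\ g \text{ outer}\}$, and $\mathsf{R}^+$ is the set of $f\in N^+$ whose radial boundary values are real a.e.~on $\mathbb{T}$. $L\log L$ is the set of measurable $w$ on $\mathbb{T}$ with $\int_{\mathbb{T}}|w|\log^+|w|\,dm<\infty$. *)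

theory Defs
  imports "HOL-Analysis.Analysis"
begin

text \<open>Normalized Lebesgue measure m on the unit circle T, realised as the
 (completed) push-forward of the uniform probability on [0, 2 pi) under cis.
 It lives on complex numbers and is concentrated on sphere 0 1.\<close>
definition circ_m :: "complex measure" where
  "circ_m = completion (distr (uniform_measure lborel {0..<2*pi}) borel cis)"

definition circ_measurable :: "complex set \<Rightarrow> bool" where
  "circ_measurable E \<longleftrightarrow> E \<in> sets circ_m \<and> E \<subseteq> sphere 0 1"

definition fE :: "complex set \<Rightarrow> complex \<Rightarrow> complex" where
  "fE E z = exp (\<i> * of_real pi * (LINT \<zeta>:E|circ_m. (\<zeta> + z) / (\<zeta> - z)))"

definition prod_abs_loc_unif :: "(nat \<Rightarrow> complex \<Rightarrow> complex) \<Rightarrow> bool" where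
  "prod_abs_loc_unif w \<longleftrightarrow>
     (\<forall>K. compact K \<and> K \<subseteq> ball 0 1 \<longrightarrow>
        uniformly_convergent_on K (\<lambda>N z. \<Sum>n<N. norm (1 - w n z)))"

definition Hinf :: "(complex \<Rightarrow> complex) \<Rightarrow> bool" where
  "Hinf g \<longleftrightarrow> g holomorphic_on ball 0 1 \<and> bounded (g ` ball 0 1)"

text \<open>Outer function: g(z) = c exp(int (zeta+z)/(zeta-z) log w(zeta) dm(zeta)),
 |c| = 1, log w in L^1; here u = log w.\<close>
definition outer :: "(complex \<Rightarrow> complex) \<Rightarrow> bool" where
  "outer g \<longleftrightarrow> (\<exists>c u. norm c = 1 \<and> integrable circ_m u \<and>
     (\<forall>z\<in>ball 0 1. g z = c * exp (LINT \<zeta>|circ_m. ((\<zeta> + z) / (\<zeta> - z)) * of_real (u \<zeta>))))"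

definition smirnov :: "(complex \<Rightarrow> complex) \<Rightarrow> bool" where
  "smirnov F \<longleftrightarrow> (\<exists>g h. Hinf g \<and> Hinf h \<and> outer h \<and>
      (\<forall>z\<in>ball 0 1. F z = g z / h z))"

definition Rplus :: "(complex \<Rightarrow> complex) \<Rightarrow> bool" where
  "Rplus F \<longleftrightarrow> smirnov F \<and>
     (AE \<zeta> in circ_m. \<exists>L::real. ((\<lambda>r::real. F (of_real r * \<zeta>)) \<longlongrightarrow> of_real L) (at_left 1))"

definition LlogL :: "(complex \<Rightarrow> real) \<Rightarrow> bool" where
  "LlogL w \<longleftrightarrow> w \<in> borel_measurable circ_m \<and>
     (\<integral>\<^sup>+ \<zeta>. ennreal (\<bar>w \<zeta>\<bar> * max 0 (ln \<bar>w \<zeta>\<bar>)) \<partial>circ_m) < \<infinity>"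

end

theory Submission
  imports Defs "HOL-Complex_Analysis.Complex_Analysis" "HOL-Probability.Probability_Measure"
begin

text \<open>
  Write H for the Herglotz integral of v. The product is F = exp (i H), and at the origin its n-th
  factor is exp (i pi m(E n)), which gives the equivalence of summability and convergence. Since
  Re H has radial limits v, with values in pi * Z, everything depends on the conjugate function
  Im H = - log |F|. Put G = 1 + H, which has real part at least 1. The mean value property of
  G Ln G bounds the circle means of |Im H| by those of (1 + Re H) log (1 + Re H) and vice versa
  (Zygmund). If v is in L log L, truncation makes the dilations of Im H Cauchy in L^1; hence Im H
  is the Poisson integral of some w in L^1, and exp of minus the Herglotz integral of |w| is a
  bounded outer denominator for F. Conversely, F = g / h with g bounded and h outer bounds Im H
  below by a Poisson integral; as Im H has mean zero, the circle means of |Im H| stay bounded, and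
  Fatou's lemma gives v in L log L.
\<close>

section \<open>Measures and integrals\<close>

lemma (in complete_measure) measurable_cong_AE:
  assumes "g \<in> measurable M N" "AE x in M. f x = g x" "f \<in> space M \<rightarrow> space N"
  shows "f \<in> measurable M N"
proof (rule measurableI)
  fix A assume "A \<in> sets N"
  show "f -` A \<inter> space M \<in> sets M"
  proof (rule in_sets_AE)
    show "AE x in M. x \<in> g -` A \<inter> space M \<longleftrightarrow> x \<in> f -` A \<inter> space M"
      using assms(2) by eventually_elim auto
    show "g -` A \<inter> space M \<in> sets M"
      using assms(1) \<open>A \<in> sets N\<close> by (rule measurable_sets)
  qed auto
qed (use assms(3) in auto)

lemma AE_if_small_exceptional_sets:
  assumes "\<And>e::real. 0 < e \<Longrightarrow> \<exists>B\<in>sets M. emeasure M B \<le> ennreal e \<and> (AE x in M. x \<notin> B \<longrightarrow> P x)"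
  shows "AE x in M. P x"
proof -
  have "\<exists>B. B \<in> sets M \<and> emeasure M B \<le> ennreal (1 / Suc n) \<and> (AE x in M. x \<notin> B \<longrightarrow> P x)" for n
    using assms[of "1 / Suc n"] by auto
  then obtain B where B: "\<And>n. B n \<in> sets M" "\<And>n. emeasure M (B n) \<le> ennreal (1 / Suc n)"
    and P: "\<And>n. AE x in M. x \<notin> B n \<longrightarrow> P x"
    by metis
  have "emeasure M (\<Inter>n. B n) \<le> ennreal (1 / Suc n)" for n
    using B by (intro order_trans[OF emeasure_mono B(2)[of n]]) auto
  moreover have "(\<lambda>n. ennreal (1 / Suc n)) \<longlonglongrightarrow> ennreal 0"
    using LIMSEQ_Suc[OF lim_1_over_n] by (intro tendsto_ennrealI) simp
  ultimately have "emeasure M (\<Inter>n. B n) \<le> ennreal 0"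
    by (intro LIMSEQ_le_const) auto
  then have "AE x in M. x \<notin> (\<Inter>n. B n)"
    using B(1) by (intro AE_not_in) auto
  moreover have "AE x in M. \<forall>n. x \<notin> B n \<longrightarrow> P x"
    unfolding AE_all_countable using P by (rule allI)
  ultimately show ?thesis
    by eventually_elim blast
qed

lemma nn_integral_le_if_AE_LIMSEQ:
  fixes f :: "nat \<Rightarrow> 'a \<Rightarrow> ennreal"
  assumes f: "\<And>n. f n \<in> borel_measurable M" and lim: "AE x in M. (\<lambda>n. f n x) \<longlonglongrightarrow> g x"
    and bound: "eventually (\<lambda>n. (\<integral>\<^sup>+x. f n x \<partial>M) \<le> C) sequentially"
  shows "(\<integral>\<^sup>+x. g x \<partial>M) \<le> C"
proof -
  have "(\<integral>\<^sup>+x. g x \<partial>M) = (\<integral>\<^sup>+x. liminf (\<lambda>n. f n x) \<partial>M)"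
    using lim by (intro nn_integral_cong_AE) (auto elim!: eventually_mono simp: lim_imp_Liminf)
  also have "\<dots> \<le> liminf (\<lambda>n. \<integral>\<^sup>+x. f n x \<partial>M)"
    using f by (rule nn_integral_liminf)
  also have "\<dots> \<le> liminf (\<lambda>n. C)"
    using bound by (rule Liminf_mono)
  finally show ?thesis
    by (simp add: Liminf_const)
qed

lemma nn_integral_norm_diff_le_if_AE_LIMSEQ:
  fixes f :: "nat \<Rightarrow> 'a \<Rightarrow> 'b::{banach, second_countable_topology}"
  assumes f: "\<And>n. integrable M (f n)" and h: "integrable M h"
    and lim: "AE x in M. (\<lambda>n. f n x) \<longlonglongrightarrow> g x"
    and bound: "eventually (\<lambda>n. (LINT x|M. norm (h x - f n x)) \<le> e) sequentially"
  shows "(\<integral>\<^sup>+x. ennreal (norm (h x - g x)) \<partial>M) \<le> ennreal e"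
proof (rule nn_integral_le_if_AE_LIMSEQ)
  show "AE x in M. (\<lambda>n. ennreal (norm (h x - f n x))) \<longlonglongrightarrow> ennreal (norm (h x - g x))"
    using lim by eventually_elim (intro tendsto_intros)
  show "eventually (\<lambda>n. (\<integral>\<^sup>+x. ennreal (norm (h x - f n x)) \<partial>M) \<le> ennreal e) sequentially"
    using bound by eventually_elim (use f h in \<open>auto simp: nn_integral_eq_integral intro: ennreal_leI\<close>)
  show "(\<lambda>x. ennreal (norm (h x - f n x))) \<in> borel_measurable M" for n
    using f h by simp
qed

lemma L1_Cauchy_imp_convergent:
  fixes f :: "nat \<Rightarrow> 'a \<Rightarrow> 'b::{banach, second_countable_topology}"
  assumes f: "\<And>n. integrable M (f n)"
    and Cauchy: "\<And>e. 0 < e \<Longrightarrow> \<exists>N. \<forall>m\<ge>N. \<forall>n\<ge>N. (LINT x|M. norm (f m x - f n x)) < e"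
  obtains g where "integrable M g" "(\<lambda>n. LINT x|M. norm (f n x - g x)) \<longlonglongrightarrow> 0"
proof -
  obtain \<sigma> where \<sigma>: "strict_mono \<sigma>" "AE x in M. Cauchy (\<lambda>i. f (\<sigma> i) x)"
    using cauchy_L1_AE_cauchy_subseq[OF f Cauchy] by blast
  define g where "g x = lim (\<lambda>i. f (\<sigma> i) x)" for x
  have [measurable]: "f n \<in> borel_measurable M" for n
    using f by simp
  have [measurable]: "g \<in> borel_measurable M"
    unfolding g_def by (rule borel_measurable_lim_metric) measurable
  have lim: "AE x in M. (\<lambda>i. f (\<sigma> i) x) \<longlonglongrightarrow> g x"
    using \<sigma>(2) by eventually_elim (simp add: g_def Cauchy_convergent_iff convergent_LIMSEQ_iff)
  have tail: "\<exists>N. \<forall>n\<ge>N. (\<integral>\<^sup>+x. ennreal (norm (f n x - g x)) \<partial>M) \<le> ennreal e" if "0 < e" for e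
  proof -
    obtain N where N: "\<And>m n. m \<ge> N \<Longrightarrow> n \<ge> N \<Longrightarrow> (LINT x|M. norm (f m x - f n x)) < e"
      using Cauchy[OF \<open>0 < e\<close>] by blast
    have "(LINT x|M. norm (f n x - f (\<sigma> i) x)) \<le> e" if "n \<ge> N" "i \<ge> N" for n i
      using N[OF that(1), of "\<sigma> i"] that(2) seq_suble[OF \<sigma>(1), of i] by simp
    then have "(\<integral>\<^sup>+x. ennreal (norm (f n x - g x)) \<partial>M) \<le> ennreal e" if "n \<ge> N" for n
      using that by (intro nn_integral_norm_diff_le_if_AE_LIMSEQ[OF f f lim])
        (auto simp: eventually_sequentially)
    then show ?thesis by blast
  qed
  obtain n where "(\<integral>\<^sup>+x. ennreal (norm (f n x - g x)) \<partial>M) \<le> ennreal 1"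
    using tail[of 1] by auto
  then have "integrable M (\<lambda>x. f n x - g x)"
    by (intro integrableI_bounded) (auto simp: le_less_trans)
  from Bochner_Integration.integrable_diff[OF f[of n] this] have g: "integrable M g"
    by simp
  have "(\<integral>\<^sup>+x. ennreal (norm (f n x - g x)) \<partial>M) = ennreal (LINT x|M. norm (f n x - g x))" for n
    using f g by (intro nn_integral_eq_integral) auto
  then have "\<exists>N. \<forall>n\<ge>N. (LINT x|M. norm (f n x - g x)) \<le> e" if "0 < e" for e
    using tail[OF that] that by simp
  then have "\<exists>N. \<forall>n\<ge>N. norm ((LINT x|M. norm (f n x - g x)) - 0) < e" if "0 < e" for e
    using that by (force dest: spec[of _ "e / 2"])
  then have "(\<lambda>n. LINT x|M. norm (f n x - g x)) \<longlonglongrightarrow> 0"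
    by (rule LIMSEQ_I)
  with g show ?thesis
    by (rule that)
qed

lemma sums_integral_dominated:
  fixes f :: "nat \<Rightarrow> 'a \<Rightarrow> 'b::{banach, second_countable_topology}" and g :: "'a \<Rightarrow> real"
  assumes f: "\<And>n. f n \<in> borel_measurable M" and F: "F \<in> borel_measurable M"
    and g: "integrable M g" and c: "summable c"
    and bound: "\<And>n. AE x in M. norm (f n x) \<le> c n * g x"
    and sums: "AE x in M. (\<lambda>n. f n x) sums F x"
  shows "(\<lambda>n. LINT x|M. f n x) sums (LINT x|M. F x)"
proof -
  have cg: "integrable M (\<lambda>x. c n * g x)" for n
    using g by (rule integrable_mult_right)
  have fi: "integrable M (f n)" for n
    using bound[of n]
    by (intro Bochner_Integration.integrable_bound[OF cg[of n] f]) (auto elim!: eventually_mono)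
  have "AE x in M. \<forall>n. norm (f n x) \<le> c n * g x"
    using bound by (simp add: AE_all_countable)
  then have "AE x in M. summable (\<lambda>n. norm (f n x))"
  proof eventually_elim
    case (elim x)
    then show ?case
      by (intro summable_comparison_test'[OF summable_mult2[OF c, of "g x"], of 0]) simp
  qed
  moreover have "summable (\<lambda>n. LINT x|M. norm (f n x))"
  proof (rule summable_comparison_test'[OF summable_mult2[OF c]])
    show "norm (LINT x|M. norm (f n x)) \<le> c n * (LINT x|M. g x)" for n
      using integral_mono_AE[OF integrable_norm[OF fi] cg bound, of n] by simp
  qed
  ultimately have "(\<lambda>n. LINT x|M. f n x) sums (LINT x|M. (\<Sum>n. f n x))"
    by (rule sums_integral[OF fi])
  also have "(LINT x|M. (\<Sum>n. f n x)) = (LINT x|M. F x)"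
    using sums f F by (intro integral_cong_AE) (auto elim!: eventually_mono simp: sums_iff)
  finally show ?thesis .
qed

lemma open_superset_zero_set:
  fixes M :: "'a::polish_space measure" and f :: "'a \<Rightarrow> ennreal"
  assumes M: "sets M = sets borel" and f: "f \<in> borel_measurable (completion M)"
    and fin: "(\<integral>\<^sup>+x. f x \<partial>completion M) < \<infinity>" and "0 < e"
  obtains U where "open U" "AE x in completion M. f x = 0 \<longrightarrow> x \<in> U"
    "(\<integral>\<^sup>+x. f x * indicator U x \<partial>completion M) < e"
proof -
  obtain g where g[measurable]: "g \<in> borel_measurable M" and fg: "AE x in M. f x = g x"
    using completion_ex_borel_measurable[OF f] by blast
  have g_borel: "g \<in> borel_measurable borel"
    using g by (simp add: measurable_cong_sets[OF M])
  have [simp]: "space M = UNIV"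
    using sets_eq_imp_space_eq[OF M] by simp
  have f_on: "(\<integral>\<^sup>+x. f x * indicator A x \<partial>completion M) = emeasure (density M g) A"
    if "A \<in> sets borel" for A
    using fg that M by (subst emeasure_density)
      (auto simp: nn_integral_completion intro!: nn_integral_cong_AE elim!: eventually_mono)
  have Z: "{x. g x = 0} \<in> sets borel"
    using g_borel by measurable
  have "emeasure (density M g) UNIV \<noteq> \<infinity>"
    using fin f_on[of UNIV] by simp
  moreover have "emeasure (density M g) {x. g x = 0} = 0"
    using Z M by (subst emeasure_density) (auto simp: nn_integral_0_iff_AE indicator_def)
  ultimately have "(INF U\<in>{U. {x. g x = 0} \<subseteq> U \<and> open U}. emeasure (density M g) U) < e"
    using outer_regular[of "density M g" "{x. g x = 0}"] M Z \<open>0 < e\<close> by simp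
  then obtain U where U: "{x. g x = 0} \<subseteq> U" "open U" "emeasure (density M g) U < e"
    unfolding INF_less_iff by auto
  show ?thesis
  proof
    show "AE x in completion M. f x = 0 \<longrightarrow> x \<in> U"
      using AE_completion[OF fg] by eventually_elim (use U(1) in auto)
  qed (use U f_on[of U] in auto)
qed

lemma emeasure_UN_countable_le:
  assumes "countable I" and A: "\<And>i. i \<in> I \<Longrightarrow> A i \<in> sets M"
  shows "emeasure M (\<Union>i\<in>I. A i) \<le> (\<integral>\<^sup>+i. emeasure M (A i) \<partial>count_space I)"
proof -
  have UN: "(\<Union>i\<in>I. A i) \<in> sets M"
    using assms by (intro sets.countable_UN') auto
  have "indicator (\<Union>i\<in>I. A i) x \<le> (\<integral>\<^sup>+i. indicator (A i) x \<partial>count_space I)" for x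
  proof (cases "x \<in> (\<Union>i\<in>I. A i)")
    case True
    then obtain j where "j \<in> I" "x \<in> A j" by auto
    then have "indicator (\<Union>i\<in>I. A i) x = (\<integral>\<^sup>+i. indicator {j} i \<partial>count_space I)"
      using True by simp
    also have "\<dots> \<le> (\<integral>\<^sup>+i. indicator (A i) x \<partial>count_space I)"
      using \<open>x \<in> A j\<close> by (intro nn_integral_mono) (auto simp: indicator_def)
    finally show ?thesis .
  qed simp
  then have "emeasure M (\<Union>i\<in>I. A i) \<le> (\<integral>\<^sup>+x. \<integral>\<^sup>+i. indicator (A i) x \<partial>count_space I \<partial>M)"
    by (subst nn_integral_indicator[OF UN, symmetric]) (intro nn_integral_mono)
  also have "\<dots> = (\<integral>\<^sup>+i. \<integral>\<^sup>+x. indicator (A i) x \<partial>M \<partial>count_space I)"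
    using assms by (intro nn_integral_count_space_nn_integral) auto
  also have "\<dots> = (\<integral>\<^sup>+i. emeasure M (A i) \<partial>count_space I)"
    using A by (intro nn_integral_cong) auto
  finally show ?thesis .
qed

lemma Vitali_measure_comparison:
  fixes M N :: "'a::euclidean_space measure"
  assumes sets: "sets borel \<subseteq> sets M" "sets N = sets M"
    and \<rho>: "\<And>x. x \<in> K \<Longrightarrow> 0 < \<rho> x \<and> \<rho> x \<le> R"
    and balls: "\<And>x. x \<in> K \<Longrightarrow> emeasure M (ball x (5 * \<rho> x)) \<le> c * emeasure N (cball x (\<rho> x))"
  obtains B where "B \<in> sets M" "K \<subseteq> B" "emeasure M B \<le> c * emeasure N (space N)"
proof -
  have [measurable]: "ball x r \<in> sets M" "cball x r \<in> sets N" for x r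
    unfolding sets(2) by (rule subsetD[OF sets(1)]; simp)+
  obtain C where C: "countable C" "C \<subseteq> K"
    and disj: "pairwise (\<lambda>x y. disjnt (cball x (\<rho> x)) (cball y (\<rho> y))) C"
    and cover: "\<And>x. x \<in> K \<Longrightarrow> \<exists>y. y \<in> C \<and> \<not> disjnt (cball x (\<rho> x)) (cball y (\<rho> y)) \<and>
      cball x (\<rho> x) \<subseteq> ball y (5 * \<rho> y)"
    using Vitali_covering_lemma_cballs_balls[of K \<rho> R "\<lambda>x. x"] \<rho> by blast
  define B where "B = (\<Union>y\<in>C. ball y (5 * \<rho> y))"
  have "emeasure M B \<le> (\<integral>\<^sup>+y. emeasure M (ball y (5 * \<rho> y)) \<partial>count_space C)"
    unfolding B_def by (rule emeasure_UN_countable_le[OF C(1)]) measurable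
  also have "\<dots> \<le> (\<integral>\<^sup>+y. c * emeasure N (cball y (\<rho> y)) \<partial>count_space C)"
    using balls C(2) by (intro nn_integral_mono) auto
  also have "\<dots> = c * emeasure N (\<Union>y\<in>C. cball y (\<rho> y))"
    using C(1) disj
    by (subst emeasure_UN_countable)
       (auto simp: nn_integral_cmult disjoint_family_on_def pairwise_def disjnt_def)
  also have "\<dots> \<le> c * emeasure N (space N)"
    by (intro mult_left_mono emeasure_space) auto
  finally have "emeasure M B \<le> c * emeasure N (space N)" .
  moreover have "K \<subseteq> B"
  proof
    fix x assume "x \<in> K"
    with \<rho> have "x \<in> cball x (\<rho> x)" by (simp add: less_imp_le)
    with cover[OF \<open>x \<in> K\<close>] show "x \<in> B" unfolding B_def by blast
  qed
  moreover have "B \<in> sets M"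
    unfolding B_def using C(1) by (intro sets.countable_UN') auto
  ultimately show ?thesis
    using that by blast
qed

lemma (in finite_measure) nn_integral_suminf_indicator_finite_iff:
  assumes E[measurable]: "\<And>n::nat. E n \<in> sets M" and "0 < c"
  shows "(\<integral>\<^sup>+x. (\<Sum>n. ennreal (c * indicator (E n) x)) \<partial>M) < \<infinity> \<longleftrightarrow> summable (\<lambda>n. measure M (E n))"
proof -
  have "(\<integral>\<^sup>+x. (\<Sum>n. ennreal (c * indicator (E n) x)) \<partial>M)
      = (\<Sum>n. \<integral>\<^sup>+x. ennreal (c * indicator (E n) x) \<partial>M)"
    by (rule nn_integral_suminf) measurable
  also have "\<dots> = (\<Sum>n. ennreal (c * measure M (E n)))"
    using \<open>0 < c\<close>
    by (intro suminf_cong)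
       (simp add: ennreal_mult nn_integral_cmult ennreal_indicator emeasure_eq_measure)
  also have "\<dots> < \<infinity> \<longleftrightarrow> summable (\<lambda>n. c * measure M (E n))"
  proof
    assume "summable (\<lambda>n. c * measure M (E n))"
    with \<open>0 < c\<close> show "(\<Sum>n. ennreal (c * measure M (E n))) < \<infinity>"
      by (subst suminf_ennreal2) auto
  next
    assume "(\<Sum>n. ennreal (c * measure M (E n))) < \<infinity>"
    with \<open>0 < c\<close> show "summable (\<lambda>n. c * measure M (E n))"
      by (intro summable_suminf_not_top) auto
  qed
  also have "\<dots> \<longleftrightarrow> summable (\<lambda>n. measure M (E n))"
    using \<open>0 < c\<close> by simp
  finally show ?thesis .
qed

lemma
  fixes v :: "'a \<Rightarrow> real" and q :: "real \<Rightarrow> real"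
  assumes v: "v \<in> borel_measurable M" "\<And>x. 0 \<le> v x" and q: "q \<in> borel_measurable borel" "q 0 = 0"
    and q_mono: "\<And>x y. 0 \<le> x \<Longrightarrow> x \<le> y \<Longrightarrow> q x \<le> q y" and int: "integrable M (\<lambda>x. q (v x))"
  shows integrable_tail: "integrable M (\<lambda>x. q (max 0 (v x - real n)))"
    and integral_tail_tendsto_0: "(\<lambda>n. LINT x|M. q (max 0 (v x - real n))) \<longlonglongrightarrow> 0"
proof -
  have meas: "(\<lambda>x. q (max 0 (v x - real n))) \<in> borel_measurable M" for n
    using v(1) by (intro measurable_compose[OF _ q(1)]) simp
  have bound: "\<bar>q (max 0 (v x - real n))\<bar> \<le> q (v x)" for x n
    using q_mono[of 0 "max 0 (v x - real n)"] q_mono[of "max 0 (v x - real n)" "v x"] q(2) v(2)[of x]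
    by auto
  show "integrable M (\<lambda>x. q (max 0 (v x - real n)))"
    using bound
    by (intro Bochner_Integration.integrable_bound[OF int meas] AE_I2)
       (simp add: order_trans[OF _ abs_ge_self])
  have "(\<lambda>n. q (max 0 (v x - real n))) \<longlonglongrightarrow> 0" for x
  proof (rule tendsto_eventually)
    obtain N where "v x < real N"
      using reals_Archimedean2 by blast
    then have "q (max 0 (v x - real n)) = 0" if "n \<ge> N" for n
      using that q(2) by (simp add: max_absorb1)
    then show "\<forall>\<^sub>F n in sequentially. q (max 0 (v x - real n)) = 0"
      by (auto simp: eventually_sequentially)
  qed
  then have "(\<lambda>n. LINT x|M. q (max 0 (v x - real n))) \<longlonglongrightarrow> (LINT x|M. 0)"
    by (intro integral_dominated_convergence[OF _ meas int]) (simp_all add: bound)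
  then show "(\<lambda>n. LINT x|M. q (max 0 (v x - real n))) \<longlonglongrightarrow> 0"
    by simp
qed

lemma partial_sums_tendsto_L1:
  fixes f :: "nat \<Rightarrow> 'a \<Rightarrow> real"
  assumes f: "\<And>n. f n \<in> borel_measurable M" "\<And>n x. 0 \<le> f n x"
    and v: "integrable M v" and sums: "AE x in M. (\<lambda>n. f n x) sums v x"
  shows "(\<lambda>N. LINT x|M. \<bar>(\<Sum>n<N. f n x) - v x\<bar>) \<longlonglongrightarrow> 0"
proof -
  have "(\<lambda>N. LINT x|M. \<bar>(\<Sum>n<N. f n x) - v x\<bar>) \<longlonglongrightarrow> (LINT x|M. 0)"
  proof (rule integral_dominated_convergence[OF _ _ v])
    show "AE x in M. (\<lambda>N. \<bar>(\<Sum>n<N. f n x) - v x\<bar>) \<longlonglongrightarrow> 0"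
      using sums by eventually_elim (simp add: sums_def tendsto_rabs_zero LIM_zero)
    show "AE x in M. norm \<bar>(\<Sum>n<N. f n x) - v x\<bar> \<le> v x" for N
      using sums
    proof eventually_elim
      case (elim x)
      then have "(\<Sum>n<N. f n x) \<le> v x"
        using sum_le_suminf[of "\<lambda>n. f n x" "{..<N}"] f(2) by (simp add: sums_iff)
      moreover have "0 \<le> (\<Sum>n<N. f n x)"
        using f(2) by (intro sum_nonneg)
      ultimately show ?case by simp
    qed
  qed (use f v in auto)
  then show ?thesis by simp
qed

lemma sums_enn2real_suminf:
  assumes "(\<Sum>n. ennreal (f n)) \<noteq> \<infinity>" "\<And>n. 0 \<le> f n"
  shows "f sums enn2real (\<Sum>n. ennreal (f n))"
proof -
  have "summable f"
    using assms by (intro summable_suminf_not_top) auto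
  then show ?thesis
    using assms(2) by (simp add: suminf_ennreal2 suminf_nonneg summable_sums)
qed

section \<open>Normalized Lebesgue measure on the circle\<close>

definition circ_borel :: "complex measure" where
  "circ_borel = distr (uniform_measure lborel {0..<2*pi}) borel cis"

lemma circ_m_eq_completion: "circ_m = completion circ_borel"
  by (simp add: circ_m_def circ_borel_def)

lemma sets_circ_borel [measurable_cong, simp]: "sets circ_borel = sets borel"
  by (simp add: circ_borel_def)

lemma space_circ_m [simp]: "space circ_m = UNIV"
  by (simp add: circ_m_def)

lemma measurable_cis [measurable]: "cis \<in> borel_measurable borel"
  by (intro borel_measurable_continuous_onI continuous_intros)

lemma emeasure_circ_borel_UNIV: "emeasure circ_borel UNIV = 1"
  unfolding circ_borel_def by (subst emeasure_distr) (auto simp: divide_ennreal)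

interpretation circ: prob_space circ_m
  using emeasure_circ_borel_UNIV by (intro prob_spaceI) (simp add: circ_m_eq_completion circ_borel_def)

interpretation circ: complete_measure circ_m
  unfolding circ_m_def by (rule completion.complete_measure_axioms)

lemma borel_measurable_circ_m: "f \<in> borel_measurable borel \<Longrightarrow> f \<in> borel_measurable circ_m"
  unfolding circ_m_eq_completion by (rule measurable_completion) simp

lemma borel_sets_circ_m: "A \<in> sets borel \<Longrightarrow> A \<in> sets circ_m"
  by (simp add: circ_m_eq_completion)

lemma AE_circ_m_norm: "AE \<zeta> in circ_m. norm \<zeta> = 1"
  unfolding circ_m_eq_completion circ_borel_def by (intro AE_completion) (subst AE_distr_iff; simp)

lemma borel_measurable_circ_m_continuous:
  fixes f :: "complex \<Rightarrow> 'a::real_normed_vector"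
  assumes "continuous_on (sphere 0 1) f"
  shows "f \<in> borel_measurable circ_m"
proof (rule circ.measurable_cong_AE)
  show "(\<lambda>\<zeta>. indicator (sphere 0 1) \<zeta> *\<^sub>R f \<zeta>) \<in> borel_measurable circ_m"
    using assms by (intro borel_measurable_circ_m borel_measurable_continuous_on_indicator) auto
  show "AE \<zeta> in circ_m. f \<zeta> = indicator (sphere 0 1) \<zeta> *\<^sub>R f \<zeta>"
    using AE_circ_m_norm by eventually_elim simp
qed simp

lemma integrable_circ_m_continuous:
  fixes f :: "complex \<Rightarrow> 'a::{banach, second_countable_topology}"
  assumes "continuous_on (sphere 0 1) f"
  shows "integrable circ_m f"
proof -
  have "bounded (f ` sphere 0 1)"
    using assms by (intro compact_imp_bounded compact_continuous_image) auto
  then obtain B where "\<And>\<zeta>. norm \<zeta> = 1 \<Longrightarrow> norm (f \<zeta>) \<le> B"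
    unfolding bounded_iff by (metis imageI mem_sphere_0)
  then have "AE \<zeta> in circ_m. norm (f \<zeta>) \<le> B"
    using AE_circ_m_norm by (auto elim: eventually_mono)
  then show ?thesis
    using assms by (intro circ.integrable_const_bound borel_measurable_circ_m_continuous)
qed

lemma integral_circ_m_eq_integral_uniform:
  fixes f :: "complex \<Rightarrow> 'a::{banach, second_countable_topology}"
  assumes [measurable]: "f \<in> borel_measurable borel"
  shows "(LINT \<zeta>|circ_m. f \<zeta>) = (1 / (2*pi)) *\<^sub>R (LINT t:{0..<2*pi}|lborel. f (cis t))"
proof -
  have "(LINT \<zeta>|circ_m. f \<zeta>) = (LINT t|uniform_measure lborel {0..<2*pi}. f (cis t))"
    unfolding circ_m_eq_completion circ_borel_def
    by (subst integral_completion) (auto simp: integral_distr)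
  also have "uniform_measure lborel {0..<2*pi}
    = density lborel (\<lambda>t. ennreal (indicator {0..<2*pi} t / (2*pi)))"
    by (auto simp: uniform_measure_def divide_ennreal[symmetric] ennreal_indicator intro!: density_cong)
  also have "(LINT t|\<dots>. f (cis t))
    = (LINT t|lborel. (indicator {0..<2*pi} t / (2*pi)) *\<^sub>R f (cis t))"
    by (rule integral_density) (auto simp: divide_nonneg_pos)
  also have "\<dots> = (1 / (2*pi)) *\<^sub>R (LINT t:{0..<2*pi}|lborel. f (cis t))"
    by (simp add: set_lebesgue_integral_def flip: integral_scaleR_right)
  finally show ?thesis .
qed

lemma integral_circ_m_continuous:
  fixes f :: "complex \<Rightarrow> 'a::euclidean_space"
  assumes f: "continuous_on (sphere 0 1) f"
  shows "(LINT \<zeta>|circ_m. f \<zeta>) = (1 / (2*pi)) *\<^sub>R integral {0..2*pi} (\<lambda>t. f (cis t))"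
proof -
  define g where "g \<zeta> = indicator (sphere 0 1) \<zeta> *\<^sub>R f \<zeta>" for \<zeta>
  have g: "g \<in> borel_measurable borel"
    unfolding g_def using f by (intro borel_measurable_continuous_on_indicator) auto
  have f_cis: "continuous_on A (\<lambda>t. f (cis t))" for A
    by (intro continuous_on_compose2[OF f] continuous_intros) auto
  then have [measurable]: "(\<lambda>t. f (cis t)) \<in> borel_measurable borel"
    by (rule borel_measurable_continuous_onI)
  have "(LINT \<zeta>|circ_m. f \<zeta>) = (LINT \<zeta>|circ_m. g \<zeta>)"
    using AE_circ_m_norm
    by (intro integral_cong_AE borel_measurable_circ_m_continuous[OF f] borel_measurable_circ_m g)
       (auto simp: g_def elim: eventually_mono)
  also have "\<dots> = (1 / (2*pi)) *\<^sub>R (LINT t:{0..<2*pi}|lborel. f (cis t))"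
    using integral_circ_m_eq_integral_uniform[OF g] by (simp add: g_def)
  also have "(LINT t:{0..<2*pi}|lborel. f (cis t)) = (LINT t:{0..2*pi}|lborel. f (cis t))"
    unfolding set_lebesgue_integral_def using AE_lborel_singleton[of "2*pi"]
    by (intro integral_cong_AE) (auto elim!: eventually_mono simp: indicator_def)
  also have "\<dots> = integral {0..2*pi} (\<lambda>t. f (cis t))"
    by (intro set_borel_integral_eq_integral borel_integrable_atLeastAtMost' f_cis)
  finally show ?thesis .
qed

lemma integral_circ_m_eq_contour_integral:
  assumes f: "continuous_on (sphere 0 1) f" and "(f has_contour_integral I) (circlepath 0 1)"
  shows "(LINT \<zeta>|circ_m. f \<zeta> * \<zeta>) = I / (2 * of_real pi * \<i>)"
proof -
  have "((\<lambda>t. f (cis t) * \<i> * cis t) has_integral I) {0..2*pi}"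
    using assms(2) has_contour_integral_part_circlepath_iff[of 0 "2*pi" f I 0 1]
    by (simp add: circlepath_def)
  then have "((\<lambda>t. f (cis t) * \<i> * cis t / \<i>) has_integral I / \<i>) {0..2*pi}"
    by (rule has_integral_divide)
  then have "integral {0..2*pi} (\<lambda>t. f (cis t) * cis t) = I / \<i>"
    by (intro integral_unique) (simp add: field_simps)
  moreover have "continuous_on (sphere 0 1) (\<lambda>\<zeta>. f \<zeta> * \<zeta>)"
    using f by (intro continuous_intros)
  ultimately show ?thesis
    by (simp add: integral_circ_m_continuous scaleR_conv_of_real field_simps)
qed

lemma integral_circ_m_Cauchy_formula:
  assumes "continuous_on (cball 0 1) f" "f holomorphic_on ball 0 1" "norm w < 1"
  shows "(LINT \<zeta>|circ_m. f \<zeta> / (\<zeta> - w) * \<zeta>) = f w"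
proof (subst integral_circ_m_eq_contour_integral)
  show "((\<lambda>\<zeta>. f \<zeta> / (\<zeta> - w)) has_contour_integral 2 * of_real pi * \<i> * f w) (circlepath 0 1)"
    using assms by (intro Cauchy_integral_circlepath) auto
  show "continuous_on (sphere 0 1) (\<lambda>\<zeta>. f \<zeta> / (\<zeta> - w))"
    using assms(3) by (intro continuous_intros continuous_on_subset[OF assms(1)]) auto
qed auto

lemma integral_circ_m_mean_value:
  assumes "continuous_on (cball 0 1) f" "f holomorphic_on ball 0 1"
  shows "(LINT \<zeta>|circ_m. f \<zeta>) = f 0"
proof -
  have "(LINT \<zeta>|circ_m. f \<zeta>) = (LINT \<zeta>|circ_m. f \<zeta> / (\<zeta> - 0) * \<zeta>)"
  proof (rule integral_cong_AE)
    show "AE \<zeta> in circ_m. f \<zeta> = f \<zeta> / (\<zeta> - 0) * \<zeta>"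
      using AE_circ_m_norm by eventually_elim auto
  qed (intro borel_measurable_circ_m_continuous continuous_intros continuous_on_subset[OF assms(1)]; auto)+
  also have "\<dots> = f 0"
    by (rule integral_circ_m_Cauchy_formula[OF assms]) simp
  finally show ?thesis .
qed

lemma norm_dilate_less: "norm \<zeta> \<le> 1 \<Longrightarrow> \<bar>r\<bar> < 1 \<Longrightarrow> norm (complex_of_real r * \<zeta>) < 1"
  using mult_left_le[of "norm \<zeta>" "\<bar>r\<bar>"] by (simp add: norm_mult)

lemma dilate_holomorphic:
  assumes "g holomorphic_on ball 0 1" "\<bar>r\<bar> < 1"
  shows "(\<lambda>\<zeta>. g (of_real r * \<zeta>)) holomorphic_on ball 0 1"
  using norm_dilate_less[OF _ assms(2)]
  by (intro holomorphic_on_compose_gen[OF _ assms(1), unfolded o_def] holomorphic_intros)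
     (auto simp: image_subset_iff)

lemma dilate_continuous:
  assumes "g holomorphic_on ball 0 1" "\<bar>r\<bar> < 1" "A \<subseteq> cball 0 1"
  shows "continuous_on A (\<lambda>\<zeta>. g (of_real r * \<zeta>))"
  using norm_dilate_less[OF _ assms(2)] assms(3)
  by (intro continuous_on_compose2[OF holomorphic_on_imp_continuous_on[OF assms(1)]] continuous_intros)
     auto

lemma dilate_mean_value:
  assumes "g holomorphic_on ball 0 1" "\<bar>r\<bar> < 1"
  shows "(LINT \<zeta>|circ_m. g (of_real r * \<zeta>)) = g 0"
  using integral_circ_m_mean_value[OF dilate_continuous dilate_holomorphic, OF assms order_refl assms]
  by simp

lemma dilate_integrable:
  assumes "g holomorphic_on ball 0 1" "\<bar>r\<bar> < 1"
  shows "integrable circ_m (\<lambda>\<zeta>. g (of_real r * \<zeta>))"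
  by (intro integrable_circ_m_continuous dilate_continuous[OF assms]) auto

section \<open>Herglotz and Poisson integrals\<close>

definition herglotz_kernel :: "complex \<Rightarrow> complex \<Rightarrow> complex" where
  "herglotz_kernel z \<zeta> = (\<zeta> + z) / (\<zeta> - z)"

definition poisson_kernel :: "complex \<Rightarrow> complex \<Rightarrow> real" where
  "poisson_kernel z \<zeta> = Re (herglotz_kernel z \<zeta>)"

definition herglotz :: "(complex \<Rightarrow> real) \<Rightarrow> complex \<Rightarrow> complex" where
  "herglotz f z = (LINT \<zeta>|circ_m. herglotz_kernel z \<zeta> * of_real (f \<zeta>))"

abbreviation poisson :: "(complex \<Rightarrow> real) \<Rightarrow> complex \<Rightarrow> real" where
  "poisson f z \<equiv> Re (herglotz f z)"

abbreviation conj_poisson :: "(complex \<Rightarrow> real) \<Rightarrow> complex \<Rightarrow> real" where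
  "conj_poisson f z \<equiv> Im (herglotz f z)"

lemma herglotz_kernel_eq: "\<zeta> \<noteq> z \<Longrightarrow> herglotz_kernel z \<zeta> = 2 * (\<zeta> / (\<zeta> - z)) - 1"
  by (simp add: herglotz_kernel_def field_simps)

lemma norm_herglotz_kernel_le:
  assumes "norm \<zeta> = 1" "norm z < 1"
  shows "norm (herglotz_kernel z \<zeta>) \<le> 2 / (1 - norm z)"
proof -
  have "1 - norm z \<le> norm (\<zeta> - z)" "norm (\<zeta> + z) \<le> 2"
    using norm_triangle_ineq2[of \<zeta> z] norm_triangle_ineq[of \<zeta> z] assms by auto
  then show ?thesis
    unfolding herglotz_kernel_def norm_divide using assms by (intro frac_le) auto
qed

lemma continuous_on_herglotz_kernel:
  "norm z < 1 \<Longrightarrow> continuous_on (sphere 0 1) (herglotz_kernel z)"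
  unfolding herglotz_kernel_def by (intro continuous_intros) auto

lemma continuous_on_poisson_kernel:
  "norm z < 1 \<Longrightarrow> continuous_on (sphere 0 1) (poisson_kernel z)"
  unfolding poisson_kernel_def by (intro continuous_intros continuous_on_herglotz_kernel)

lemma integrable_herglotz_kernel_mult:
  assumes f: "integrable circ_m f" and z: "norm z < 1"
  shows "integrable circ_m (\<lambda>\<zeta>. herglotz_kernel z \<zeta> * of_real (f \<zeta>))"
proof (rule Bochner_Integration.integrable_bound)
  show "integrable circ_m (\<lambda>\<zeta>. 2 / (1 - norm z) * f \<zeta>)"
    using f by (rule integrable_mult_right)
  show "(\<lambda>\<zeta>. herglotz_kernel z \<zeta> * of_real (f \<zeta>)) \<in> borel_measurable circ_m"
    using f borel_measurable_circ_m_continuous[OF continuous_on_herglotz_kernel[OF z]] by simp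
  show "AE \<zeta> in circ_m. norm (herglotz_kernel z \<zeta> * of_real (f \<zeta>)) \<le> norm (2 / (1 - norm z) * f \<zeta>)"
    using AE_circ_m_norm
  proof eventually_elim
    case (elim \<zeta>)
    with z show ?case
      unfolding norm_mult norm_of_real real_norm_def abs_mult
      by (intro mult_right_mono order_trans[OF norm_herglotz_kernel_le]) auto
  qed
qed

lemma herglotz_add:
  assumes "integrable circ_m f" "integrable circ_m g" "norm z < 1"
  shows "herglotz (\<lambda>\<zeta>. f \<zeta> + g \<zeta>) z = herglotz f z + herglotz g z"
  unfolding herglotz_def of_real_add distrib_left
  using assms by (intro Bochner_Integration.integral_add integrable_herglotz_kernel_mult)

lemma herglotz_cmult: "herglotz (\<lambda>\<zeta>. c * f \<zeta>) z = of_real c * herglotz f z"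
  unfolding herglotz_def of_real_mult mult.left_commute[of _ "complex_of_real c"]
  by (rule integral_mult_right_zero)

lemma herglotz_minus: "herglotz (\<lambda>\<zeta>. - f \<zeta>) z = - herglotz f z"
  using herglotz_cmult[of "-1" f z] by simp

lemma herglotz_diff:
  assumes "integrable circ_m f" "integrable circ_m g" "norm z < 1"
  shows "herglotz (\<lambda>\<zeta>. f \<zeta> - g \<zeta>) z = herglotz f z - herglotz g z"
  using herglotz_add[of f "\<lambda>\<zeta>. - g \<zeta>" z] assms by (simp add: herglotz_minus)

lemma herglotz_sum:
  assumes "\<And>i. i \<in> I \<Longrightarrow> integrable circ_m (f i)" "norm z < 1"
  shows "herglotz (\<lambda>\<zeta>. \<Sum>i\<in>I. f i \<zeta>) z = (\<Sum>i\<in>I. herglotz (f i) z)"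
  unfolding herglotz_def of_real_sum sum_distrib_left
  using assms by (intro Bochner_Integration.integral_sum integrable_herglotz_kernel_mult)

lemma herglotz_0:
  assumes "integrable circ_m f"
  shows "herglotz f 0 = of_real (LINT \<zeta>|circ_m. f \<zeta>)"
proof -
  have "AE \<zeta> in circ_m. herglotz_kernel 0 \<zeta> * complex_of_real (f \<zeta>) = complex_of_real (f \<zeta>)"
    using AE_circ_m_norm by eventually_elim (auto simp: herglotz_kernel_def)
  then have "herglotz f 0 = (LINT \<zeta>|circ_m. complex_of_real (f \<zeta>))"
    unfolding herglotz_def
    using assms integrable_herglotz_kernel_mult[OF assms, of 0] by (intro integral_cong_AE) auto
  then show ?thesis by simp
qed

lemma norm_herglotz_le:
  assumes f: "integrable circ_m f" and z: "norm z < 1"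
  shows "norm (herglotz f z) \<le> 2 / (1 - norm z) * (LINT \<zeta>|circ_m. \<bar>f \<zeta>\<bar>)"
proof -
  have "norm (herglotz f z) \<le> (LINT \<zeta>|circ_m. norm (herglotz_kernel z \<zeta> * of_real (f \<zeta>)))"
    unfolding herglotz_def by (rule integral_norm_bound)
  also have "\<dots> \<le> (LINT \<zeta>|circ_m. 2 / (1 - norm z) * \<bar>f \<zeta>\<bar>)"
  proof (rule integral_mono_AE)
    show "AE \<zeta> in circ_m. norm (herglotz_kernel z \<zeta> * of_real (f \<zeta>)) \<le> 2 / (1 - norm z) * \<bar>f \<zeta>\<bar>"
      using AE_circ_m_norm
    proof eventually_elim
      case (elim \<zeta>)
      then show ?case
        unfolding norm_mult norm_of_real by (intro mult_right_mono norm_herglotz_kernel_le z) auto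
    qed
  qed (use f integrable_norm[OF integrable_herglotz_kernel_mult[OF f z]] in auto)
  finally show ?thesis by simp
qed

lemma tendsto_herglotz_L1:
  assumes f: "\<And>n. integrable circ_m (f n)" "integrable circ_m g" and z: "norm z < 1"
    and lim: "(\<lambda>n. LINT \<zeta>|circ_m. \<bar>f n \<zeta> - g \<zeta>\<bar>) \<longlonglongrightarrow> 0"
  shows "(\<lambda>n. herglotz (f n) z) \<longlonglongrightarrow> herglotz g z"
proof (rule Lim_null[THEN iffD2], rule Lim_null_comparison)
  have "norm (herglotz (f n) z - herglotz g z) \<le> 2 / (1 - norm z) * (LINT \<zeta>|circ_m. \<bar>f n \<zeta> - g \<zeta>\<bar>)" for n
    using f z norm_herglotz_le[of "\<lambda>\<zeta>. f n \<zeta> - g \<zeta>" z] by (simp add: herglotz_diff)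
  then show "\<forall>\<^sub>F n in sequentially. norm (herglotz (f n) z - herglotz g z)
      \<le> 2 / (1 - norm z) * (LINT \<zeta>|circ_m. \<bar>f n \<zeta> - g \<zeta>\<bar>)"
    by simp
  show "(\<lambda>n. 2 / (1 - norm z) * (LINT \<zeta>|circ_m. \<bar>f n \<zeta> - g \<zeta>\<bar>)) \<longlonglongrightarrow> 0"
    by (rule tendsto_mult_right_zero[OF lim])
qed

lemma herglotz_sums:
  assumes f: "integrable circ_m f" and z: "norm z < 1"
  shows "(\<lambda>n. (LINT \<zeta>|circ_m. 2 * (1 / \<zeta>) ^ n * of_real (f \<zeta>)) * z ^ n)
    sums (herglotz f z + of_real (LINT \<zeta>|circ_m. f \<zeta>))"
proof -
  have "(\<lambda>n. LINT \<zeta>|circ_m. 2 * (z / \<zeta>) ^ n * complex_of_real (f \<zeta>))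
    sums (LINT \<zeta>|circ_m. herglotz_kernel z \<zeta> * of_real (f \<zeta>) + of_real (f \<zeta>))"
  proof (rule sums_integral_dominated[where c = "\<lambda>n. 2 * norm z ^ n"])
    show "AE \<zeta> in circ_m. (\<lambda>n. 2 * (z / \<zeta>) ^ n * complex_of_real (f \<zeta>))
        sums (herglotz_kernel z \<zeta> * of_real (f \<zeta>) + of_real (f \<zeta>))"
      using AE_circ_m_norm
    proof eventually_elim
      case (elim \<zeta>)
      then have nz: "norm (z / \<zeta>) < 1" "\<zeta> \<noteq> z" "\<zeta> \<noteq> 0"
        using z by (auto simp: norm_divide)
      then have "(\<lambda>n. 2 * (z / \<zeta>) ^ n * complex_of_real (f \<zeta>))
          sums (2 * (1 / (1 - z / \<zeta>)) * of_real (f \<zeta>))"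
        by (intro sums_mult sums_mult2 geometric_sums)
      moreover have "1 / (1 - z / \<zeta>) = \<zeta> / (\<zeta> - z)"
        using nz by (simp add: field_simps)
      ultimately show ?case
        using nz by (simp add: herglotz_kernel_eq algebra_simps)
    qed
    show "AE \<zeta> in circ_m. norm (2 * (z / \<zeta>) ^ n * complex_of_real (f \<zeta>)) \<le> 2 * norm z ^ n * \<bar>f \<zeta>\<bar>" for n
      using AE_circ_m_norm by eventually_elim (simp add: norm_mult norm_power norm_divide)
    have "(\<lambda>\<zeta>. (z / \<zeta>) ^ n) \<in> borel_measurable circ_m" for n
      by (intro borel_measurable_circ_m_continuous continuous_intros) auto
    then show "(\<lambda>\<zeta>. 2 * (z / \<zeta>) ^ n * complex_of_real (f \<zeta>)) \<in> borel_measurable circ_m" for n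
      using f by simp
  qed (use f z integrable_herglotz_kernel_mult[OF f z] in \<open>auto simp: summable_geometric\<close>)
  also have "(LINT \<zeta>|circ_m. herglotz_kernel z \<zeta> * of_real (f \<zeta>) + of_real (f \<zeta>))
    = herglotz f z + of_real (LINT \<zeta>|circ_m. f \<zeta>)"
    unfolding herglotz_def using integrable_herglotz_kernel_mult[OF f z] f by simp
  also have "(\<lambda>n. LINT \<zeta>|circ_m. 2 * (z / \<zeta>) ^ n * complex_of_real (f \<zeta>))
    = (\<lambda>n. (LINT \<zeta>|circ_m. 2 * (1 / \<zeta>) ^ n * complex_of_real (f \<zeta>)) * z ^ n)"
    unfolding integral_mult_left_zero[symmetric]
    by (intro ext Bochner_Integration.integral_cong) (auto simp: power_divide)
  finally show ?thesis .
qed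

lemma herglotz_holomorphic:
  assumes f: "integrable circ_m f"
  shows "herglotz f holomorphic_on ball 0 1"
proof -
  have "(\<lambda>z. herglotz f z + of_real (LINT \<zeta>|circ_m. f \<zeta>)) holomorphic_on ball 0 1"
    using herglotz_sums[OF f] by (intro power_series_holomorphic) auto
  then have "(\<lambda>z. (herglotz f z + of_real (LINT \<zeta>|circ_m. f \<zeta>)) - of_real (LINT \<zeta>|circ_m. f \<zeta>))
    holomorphic_on ball 0 1"
    by (rule holomorphic_on_diff) (rule holomorphic_on_const)
  then show ?thesis by simp
qed

lemma poisson_kernel_eq:
  assumes "norm \<zeta> = 1"
  shows "poisson_kernel z \<zeta> = (1 - (norm z)\<^sup>2) / (norm (\<zeta> - z))\<^sup>2"
proof -
  have "poisson_kernel z \<zeta> = Re ((\<zeta> + z) * cnj (\<zeta> - z)) / (norm (\<zeta> - z))\<^sup>2"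
    unfolding poisson_kernel_def herglotz_kernel_def complex_div_cnj[of "\<zeta> + z"]
    by (simp flip: of_real_power)
  also have "Re ((\<zeta> + z) * cnj (\<zeta> - z)) = (norm \<zeta>)\<^sup>2 - (norm z)\<^sup>2"
    unfolding cmod_power2 by (simp add: algebra_simps power2_eq_square)
  finally show ?thesis
    using assms by simp
qed

lemma poisson_kernel_pos: "norm \<zeta> = 1 \<Longrightarrow> norm z < 1 \<Longrightarrow> 0 < poisson_kernel z \<zeta>"
  by (subst poisson_kernel_eq) (auto intro!: divide_pos_pos simp: abs_square_less_1)

lemma poisson_kernel_eq_Cauchy_kernels:
  assumes \<zeta>: "norm \<zeta> = 1" and z: "norm z < 1"
  shows "of_real (poisson_kernel z \<zeta>) = \<zeta> / (\<zeta> - z) + cnj z * \<zeta> / (1 - cnj z * \<zeta>)"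
proof -
  have \<zeta>_cnj: "\<zeta> * cnj \<zeta> = 1"
    using \<zeta> by (simp add: complex_norm_square[symmetric])
  have "norm (cnj z * \<zeta>) < 1" "\<zeta> \<noteq> z"
    using assms by (auto simp: norm_mult)
  then have nz: "1 - cnj z * \<zeta> \<noteq> 0" "\<zeta> - z \<noteq> 0" "\<zeta> \<noteq> 0"
    using \<zeta> by auto
  have "cnj (herglotz_kernel z \<zeta>) = ((cnj \<zeta> + cnj z) * \<zeta>) / ((cnj \<zeta> - cnj z) * \<zeta>)"
    using nz by (simp add: herglotz_kernel_def)
  also have "\<dots> = (1 + cnj z * \<zeta>) / (1 - cnj z * \<zeta>)"
    using \<zeta>_cnj by (simp add: algebra_simps)
  finally have "2 * of_real (poisson_kernel z \<zeta>)
    = herglotz_kernel z \<zeta> + (1 + cnj z * \<zeta>) / (1 - cnj z * \<zeta>)"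
    using complex_add_cnj[of "herglotz_kernel z \<zeta>"] by (simp add: poisson_kernel_def)
  also have "(1 + cnj z * \<zeta>) / (1 - cnj z * \<zeta>) = 2 * (cnj z * \<zeta> / (1 - cnj z * \<zeta>)) + 1"
    using nz(1) by (simp add: divide_simps)
  also have "herglotz_kernel z \<zeta> = 2 * (\<zeta> / (\<zeta> - z)) - 1"
    using nz(2) by (intro herglotz_kernel_eq) auto
  finally have "2 * of_real (poisson_kernel z \<zeta>) = 2 * (\<zeta> / (\<zeta> - z) + cnj z * \<zeta> / (1 - cnj z * \<zeta>))"
    by (simp add: distrib_left)
  then show ?thesis by (simp only: mult_cancel_left) simp
qed

lemma poisson_kernel_reproduces:
  assumes f: "continuous_on (cball 0 1) f" "f holomorphic_on ball 0 1" and z: "norm z < 1"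
  shows "(LINT \<zeta>|circ_m. f \<zeta> * of_real (poisson_kernel z \<zeta>)) = f z"
proof -
  let ?A = "\<lambda>\<zeta>. f \<zeta> / (\<zeta> - z) * \<zeta>" and ?B = "\<lambda>\<zeta>. f \<zeta> * (cnj z * \<zeta> / (1 - cnj z * \<zeta>))"
  have nz: "1 - cnj z * \<zeta> \<noteq> 0" if "norm \<zeta> \<le> 1" for \<zeta>
  proof -
    have "norm (cnj z * \<zeta>) < 1"
      using mult_left_le[of "norm \<zeta>" "norm z"] that z by (simp add: norm_mult)
    then show ?thesis
      by (metis eq_iff_diff_eq_0 norm_one less_irrefl)
  qed
  have f_circ: "continuous_on (sphere 0 1) f"
    using f(1) by (rule continuous_on_subset) auto
  have A: "continuous_on (sphere 0 1) ?A"
    using z by (intro continuous_intros f_circ) auto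
  have B: "continuous_on (cball 0 1) ?B"
    using nz by (intro continuous_intros f(1)) auto
  note B_circ = continuous_on_subset[OF B sphere_cball]
  have "(LINT \<zeta>|circ_m. f \<zeta> * of_real (poisson_kernel z \<zeta>)) = (LINT \<zeta>|circ_m. ?A \<zeta> + ?B \<zeta>)"
  proof (rule integral_cong_AE)
    show "AE \<zeta> in circ_m. f \<zeta> * of_real (poisson_kernel z \<zeta>) = ?A \<zeta> + ?B \<zeta>"
      using AE_circ_m_norm
      by eventually_elim (simp add: poisson_kernel_eq_Cauchy_kernels z distrib_left)
  qed (intro borel_measurable_circ_m_continuous continuous_intros f_circ A B_circ
      continuous_on_poisson_kernel z)+
  also have "\<dots> = (LINT \<zeta>|circ_m. ?A \<zeta>) + (LINT \<zeta>|circ_m. ?B \<zeta>)"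
    by (intro Bochner_Integration.integral_add integrable_circ_m_continuous A B_circ)
  also have "(LINT \<zeta>|circ_m. ?A \<zeta>) = f z"
    by (rule integral_circ_m_Cauchy_formula[OF f z])
  also have "(LINT \<zeta>|circ_m. ?B \<zeta>) = ?B 0"
    using nz by (intro integral_circ_m_mean_value B) (auto intro!: holomorphic_intros f(2))
  finally show ?thesis by simp
qed

lemma integral_poisson_kernel: "norm z < 1 \<Longrightarrow> (LINT \<zeta>|circ_m. poisson_kernel z \<zeta>) = 1"
  using poisson_kernel_reproduces[of "\<lambda>_. 1" z] by (simp add: of_real_eq_1_iff flip: integral_of_real)

lemma integrable_poisson_kernel: "norm z < 1 \<Longrightarrow> integrable circ_m (poisson_kernel z)"
  by (intro integrable_circ_m_continuous continuous_on_poisson_kernel)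

lemma
  assumes "integrable circ_m f" "norm z < 1"
  shows integrable_poisson_kernel_mult: "integrable circ_m (\<lambda>\<zeta>. poisson_kernel z \<zeta> * f \<zeta>)"
    and poisson_eq_integral: "poisson f z = (LINT \<zeta>|circ_m. poisson_kernel z \<zeta> * f \<zeta>)"
  using integrable_Re[OF integrable_herglotz_kernel_mult[OF assms]]
    integral_Re[OF integrable_herglotz_kernel_mult[OF assms]]
  by (simp_all add: herglotz_def poisson_kernel_def)

lemma poisson_mono:
  assumes f: "integrable circ_m f" and g: "integrable circ_m g" and z: "norm z < 1"
    and fg: "AE \<zeta> in circ_m. f \<zeta> \<le> g \<zeta>"
  shows "poisson f z \<le> poisson g z"
  unfolding poisson_eq_integral[OF f z] poisson_eq_integral[OF g z]
proof (rule integral_mono_AE)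
  show "AE \<zeta> in circ_m. poisson_kernel z \<zeta> * f \<zeta> \<le> poisson_kernel z \<zeta> * g \<zeta>"
    using AE_circ_m_norm fg
    by eventually_elim (simp add: mult_left_mono poisson_kernel_pos z less_imp_le)
qed (auto intro!: integrable_poisson_kernel_mult f g z)

lemma poisson_const: "norm z < 1 \<Longrightarrow> poisson (\<lambda>_. c) z = c"
  by (simp add: poisson_eq_integral integral_poisson_kernel)

lemma poisson_nonneg:
  assumes "integrable circ_m f" "\<And>\<zeta>. 0 \<le> f \<zeta>" "norm z < 1"
  shows "0 \<le> poisson f z"
  using poisson_mono[of "\<lambda>_. 0" f z] assms poisson_const[of z 0] by auto

lemma poisson_Jensen:
  assumes f: "integrable circ_m f" "AE \<zeta> in circ_m. f \<zeta> \<in> I"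
    and I: "I = {a<..<b} \<or> I = {a<..} \<or> I = {..<b} \<or> I = UNIV"
    and q: "integrable circ_m (\<lambda>\<zeta>. q (f \<zeta>))" "convex_on I q" and z: "norm z < 1"
  shows "q (poisson f z) \<le> poisson (\<lambda>\<zeta>. q (f \<zeta>)) z"
proof -
  define P where "P = density circ_m (\<lambda>\<zeta>. ennreal (poisson_kernel z \<zeta>))"
  have kernel: "poisson_kernel z \<in> borel_measurable circ_m" "AE \<zeta> in circ_m. 0 \<le> poisson_kernel z \<zeta>"
    using integrable_poisson_kernel[OF z] AE_circ_m_norm
    by (auto elim!: eventually_mono intro: less_imp_le poisson_kernel_pos z)
  have P: "integrable P g \<and> poisson g z = (LINT \<zeta>|P. g \<zeta>)" if g: "integrable circ_m g" for g
    unfolding P_def using integrable_poisson_kernel_mult[OF g z] poisson_eq_integral[OF g z] kernel g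
    by (simp add: integrable_density integral_density)
  interpret P: prob_space P
  proof
    have "emeasure P UNIV = (\<integral>\<^sup>+\<zeta>. poisson_kernel z \<zeta> \<partial>circ_m)"
      unfolding P_def using kernel(1) by (subst emeasure_density) (auto simp: borel_sets_circ_m)
    then show "emeasure P (space P) = 1"
      using kernel(2)
      by (simp add: P_def nn_integral_eq_integral integrable_poisson_kernel integral_poisson_kernel z)
  qed
  have "AE \<zeta> in P. f \<zeta> \<in> I"
    unfolding P_def using kernel(1) f(2) by (auto simp: AE_density elim!: eventually_mono)
  then have "q (LINT \<zeta>|P. f \<zeta>) \<le> (LINT \<zeta>|P. q (f \<zeta>))"
    using P f(1) q by (intro P.jensens_inequality[OF _ _ I]) auto
  then show ?thesis
    using P f(1) q(1) by simp
qed

section \<open>The maximal function and radial limits\<close>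

definition maximal :: "'a::metric_space measure \<Rightarrow> 'a \<Rightarrow> ennreal" where
  "maximal \<mu> z = (SUP \<rho>\<in>{0<..}. emeasure \<mu> (cball z \<rho>) / ennreal \<rho>)"

lemma emeasure_cball_le_maximal:
  assumes "0 < \<rho>"
  shows "emeasure \<mu> (cball z \<rho>) \<le> maximal \<mu> z * ennreal \<rho>"
proof -
  have "emeasure \<mu> (cball z \<rho>) / ennreal \<rho> \<le> maximal \<mu> z"
    unfolding maximal_def using assms by (intro SUP_upper) auto
  then have "emeasure \<mu> (cball z \<rho>) / ennreal \<rho> * ennreal \<rho> \<le> maximal \<mu> z * ennreal \<rho>"
    by (rule mult_right_mono) simp
  then show ?thesis
    using assms by (simp add: ennreal_divide_times mult_divide_eq_ennreal)
qed

lemma less_maximalD: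
  assumes "c < maximal \<mu> z"
  shows "\<exists>\<rho>>0. c * ennreal \<rho> < emeasure \<mu> (cball z \<rho>)"
proof -
  obtain \<rho> where \<rho>: "0 < \<rho>" "c < emeasure \<mu> (cball z \<rho>) / ennreal \<rho>"
    using assms by (auto simp: maximal_def less_SUP_iff)
  then have "\<not> emeasure \<mu> (cball z \<rho>) \<le> ennreal \<rho> * c"
    using divide_le_posI_ennreal[of "ennreal \<rho>" "emeasure \<mu> (cball z \<rho>)" c] by (auto dest: leD)
  with \<rho>(1) show ?thesis
    by (auto simp: not_le mult.commute)
qed

lemma eventually_dilate_in_disk:
  assumes "norm z = 1"
  shows "\<forall>\<^sub>F r in at_left 1. 0 < r \<and> r < 1 \<and> norm (complex_of_real r * z) < 1"
  using eventually_at_left_real[OF zero_less_one] assms by (auto elim!: eventually_mono simp: norm_mult)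

lemma poisson_kernel_ge:
  assumes "norm \<zeta> = 1" "norm z = 1" "0 < \<rho>" "\<rho> \<le> 1" "dist z \<zeta> \<le> \<rho>"
  shows "1 / (4 * \<rho>) \<le> poisson_kernel (of_real (1 - \<rho>) * z) \<zeta>"
proof -
  let ?w = "of_real (1 - \<rho>) * z"
  have w: "norm ?w = 1 - \<rho>"
    using assms by (simp add: norm_mult del: of_real_diff)
  have "z - ?w = of_real \<rho> * z"
    by (simp add: algebra_simps)
  then have "dist z ?w = \<rho>"
    using assms by (simp add: dist_norm norm_mult)
  then have upper: "norm (\<zeta> - ?w) \<le> 2 * \<rho>"
    using dist_triangle3[of \<zeta> ?w z] assms by (simp add: dist_norm)
  have pos: "0 < norm (\<zeta> - ?w)"
    using norm_triangle_ineq2[of \<zeta> ?w] w assms by linarith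
  have "\<rho> \<le> 1 - (1 - \<rho>)\<^sup>2"
    using mult_left_le[of \<rho> \<rho>] assms by (simp add: power2_eq_square algebra_simps)
  have "1 / (4 * \<rho>) = \<rho> / (2 * \<rho>)\<^sup>2"
    using assms by (simp add: power2_eq_square)
  also have "\<dots> \<le> (1 - (1 - \<rho>)\<^sup>2) / (norm (\<zeta> - ?w))\<^sup>2"
  proof (rule frac_le)
    show "(norm (\<zeta> - ?w))\<^sup>2 \<le> (2 * \<rho>)\<^sup>2"
      using upper by (intro power_mono) auto
  qed (use assms(3) pos \<open>\<rho> \<le> 1 - (1 - \<rho>)\<^sup>2\<close> in \<open>linarith | simp\<close>)+
  also have "\<dots> = poisson_kernel ?w \<zeta>"
    using poisson_kernel_eq[OF assms(1), of ?w] w by simp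
  finally show ?thesis .
qed

lemma poisson_kernel_le:
  assumes "norm \<zeta> = 1" "norm z = 1" "0 \<le> r" "r < 1"
  shows "poisson_kernel (of_real r * z) \<zeta> \<le> 18 * (1 - r) / (1 - r + dist z \<zeta>)\<^sup>2"
proof -
  let ?w = "of_real r * z"
  have w: "norm ?w = r"
    using assms by (simp add: norm_mult)
  have "z - ?w = of_real (1 - r) * z"
    by (simp add: algebra_simps)
  then have "dist z ?w = 1 - r"
    using assms by (simp add: dist_norm norm_mult del: of_real_diff)
  then have "dist z \<zeta> \<le> norm (\<zeta> - ?w) + (1 - r)"
    using dist_triangle2[of z \<zeta> ?w] by (simp add: dist_norm)
  moreover have "1 - r \<le> norm (\<zeta> - ?w)"
    using norm_triangle_ineq2[of \<zeta> ?w] assms w by simp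
  ultimately have lower: "(1 - r + dist z \<zeta>) / 3 \<le> norm (\<zeta> - ?w)"
    by (simp add: field_simps)
  have pos: "0 < 1 - r + dist z \<zeta>"
    using assms by (simp add: add_pos_nonneg)
  have "poisson_kernel ?w \<zeta> = (1 - r\<^sup>2) / (norm (\<zeta> - ?w))\<^sup>2"
    using poisson_kernel_eq[OF assms(1), of ?w] w by simp
  also have "\<dots> \<le> (2 * (1 - r)) / ((1 - r + dist z \<zeta>) / 3)\<^sup>2"
  proof (rule frac_le)
    show "1 - r\<^sup>2 \<le> 2 * (1 - r)"
      using zero_le_power2[of "1 - r"] by (simp add: power2_eq_square algebra_simps)
    show "((1 - r + dist z \<zeta>) / 3)\<^sup>2 \<le> (norm (\<zeta> - ?w))\<^sup>2"
      using lower pos by (intro power_mono) auto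
  qed (use assms pos in auto)
  finally show ?thesis
    by (simp add: power_divide)
qed

lemma emeasure_circ_m_ball_le:
  assumes "norm z = 1" "0 < \<rho>"
  shows "emeasure circ_m (ball z \<rho>) \<le> ennreal (4 * \<rho>)"
proof (cases "\<rho> \<le> 1")
  case False
  then have "circ.prob (ball z \<rho>) \<le> 4 * \<rho>"
    using circ.prob_le_1[of "ball z \<rho>"] by linarith
  then show ?thesis
    by (simp add: circ.emeasure_eq_measure ennreal_leI)
next
  case True
  let ?w = "of_real (1 - \<rho>) * z"
  have w: "norm ?w < 1"
    using True assms by (simp add: norm_mult del: of_real_diff)
  have [simp]: "ball z \<rho> \<in> sets circ_m"
    by (intro borel_sets_circ_m) auto
  \<comment> \<open>The Poisson kernel at \<open>?w\<close> has mean 1 and is at least 1 / (4 \<rho>) on the ball.\<close>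
  have "measure circ_m (ball z \<rho>) / (4 * \<rho>) = (LINT \<zeta>|circ_m. 1 / (4 * \<rho>) * indicator (ball z \<rho>) \<zeta>)"
    by simp
  also have "\<dots> \<le> (LINT \<zeta>|circ_m. poisson_kernel ?w \<zeta>)"
  proof (rule integral_mono_AE)
    show "AE \<zeta> in circ_m. 1 / (4 * \<rho>) * indicator (ball z \<rho>) \<zeta> \<le> poisson_kernel ?w \<zeta>"
      using AE_circ_m_norm
    proof eventually_elim
      case (elim \<zeta>)
      then show ?case
        using poisson_kernel_ge[OF elim assms True] poisson_kernel_pos[OF elim w]
        by (auto simp: indicator_def simp del: of_real_diff)
    qed
  qed (simp_all add: integrable_poisson_kernel[OF w] circ.emeasure_eq_measure del: of_real_diff)
  also have "\<dots> = 1"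
    by (rule integral_poisson_kernel[OF w])
  finally show ?thesis
    using assms by (auto simp: circ.emeasure_eq_measure field_simps intro!: ennreal_leI)
qed

lemma maximal_weak_type:
  assumes \<mu>: "sets \<mu> = sets circ_m" "emeasure \<mu> UNIV < \<infinity>" and "0 < \<epsilon>"
  obtains B where "B \<in> sets circ_m" "{z \<in> sphere 0 1. ennreal \<epsilon> < maximal \<mu> z} \<subseteq> B"
    "emeasure circ_m B \<le> ennreal (20 / \<epsilon>) * emeasure \<mu> UNIV"
proof -
  have [simp]: "space \<mu> = UNIV"
    using sets_eq_imp_space_eq[OF \<mu>(1)] by simp
  obtain b where b: "emeasure \<mu> UNIV = ennreal b" "0 \<le> b"
    using \<mu>(2) by (cases "emeasure \<mu> UNIV") auto
  define K where "K = {z \<in> sphere 0 1. ennreal \<epsilon> < maximal \<mu> z}"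
  have "\<exists>\<rho>>0. ennreal \<epsilon> * ennreal \<rho> < emeasure \<mu> (cball z \<rho>)" if "z \<in> K" for z
    using that by (intro less_maximalD) (simp add: K_def)
  then obtain \<rho> where \<rho>: "\<And>z. z \<in> K \<Longrightarrow> 0 < \<rho> z"
      "\<And>z. z \<in> K \<Longrightarrow> ennreal \<epsilon> * ennreal (\<rho> z) < emeasure \<mu> (cball z (\<rho> z))"
    by metis
  have \<rho>_le: "\<rho> z \<le> b / \<epsilon>" if "z \<in> K" for z
  proof -
    have "ennreal (\<epsilon> * \<rho> z) < ennreal b"
      using \<rho>[OF that] \<open>0 < \<epsilon>\<close> emeasure_space[of \<mu> "cball z (\<rho> z)"] b by (simp add: ennreal_mult)
    then show ?thesis
      using b \<open>0 < \<epsilon>\<close> \<rho>(1)[OF that] by (simp add: ennreal_less_iff field_simps)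
  qed
  have balls: "emeasure circ_m (ball z (5 * \<rho> z)) \<le> ennreal (20 / \<epsilon>) * emeasure \<mu> (cball z (\<rho> z))"
    if "z \<in> K" for z
  proof -
    have "emeasure circ_m (ball z (5 * \<rho> z)) \<le> ennreal (4 * (5 * \<rho> z))"
      using that \<rho>(1)[OF that] by (intro emeasure_circ_m_ball_le) (auto simp: K_def)
    also have "\<dots> = ennreal (20 / \<epsilon>) * (ennreal \<epsilon> * ennreal (\<rho> z))"
      using \<open>0 < \<epsilon>\<close> \<rho>(1)[OF that] by (simp flip: ennreal_mult)
    also have "\<dots> \<le> ennreal (20 / \<epsilon>) * emeasure \<mu> (cball z (\<rho> z))"
      using \<rho>(2)[OF that] by (intro mult_left_mono) auto
    finally show ?thesis .
  qed
  have "sets borel \<subseteq> sets circ_m"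
    using borel_sets_circ_m by blast
  from Vitali_measure_comparison[OF this \<mu>(1), of K \<rho> "b / \<epsilon>", OF _ balls] \<rho>(1) \<rho>_le
  obtain B where "B \<in> sets circ_m" "K \<subseteq> B" "emeasure circ_m B \<le> ennreal (20 / \<epsilon>) * emeasure \<mu> UNIV"
    by auto
  then show ?thesis
    unfolding K_def by (rule that)
qed

lemma poisson_kernel_le_dyadic:
  assumes "norm \<zeta> = 1" "norm z = 1" "0 \<le> r" "r < 1"
  shows "ennreal (poisson_kernel (of_real r * z) \<zeta>)
    \<le> (\<Sum>k. ennreal (72 / (4 ^ k * (1 - r))) * indicator (cball z (2 ^ k * (1 - r))) \<zeta>)"
proof -
  define t where "t k = ennreal (72 / (4 ^ k * (1 - r))) * indicator (cball z (2 ^ k * (1 - r))) \<zeta>" for k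
  define \<rho> where "\<rho> = 1 - r"
  have \<rho>: "0 < \<rho>"
    using assms by (simp add: \<rho>_def)
  obtain n where "dist z \<zeta> / \<rho> < 2 ^ n"
    using real_arch_pow[of 2 "dist z \<zeta> / \<rho>"] by auto
  then have "dist z \<zeta> \<le> 2 ^ n * \<rho>"
    using \<rho> by (simp add: field_simps)
  define k where "k = (LEAST k. dist z \<zeta> \<le> 2 ^ k * \<rho>)"
  have k: "dist z \<zeta> \<le> 2 ^ k * \<rho>"
    unfolding k_def by (rule LeastI) fact
  have pos: "0 < \<rho> + dist z \<zeta>"
    using \<rho> by (simp add: add_pos_nonneg)
  have "2 ^ k * \<rho> \<le> 2 * (\<rho> + dist z \<zeta>)"
  proof (cases k)
    case (Suc j)
    then have "\<not> dist z \<zeta> \<le> 2 ^ j * \<rho>"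
      using not_less_Least[of j "\<lambda>k. dist z \<zeta> \<le> 2 ^ k * \<rho>"] by (simp add: k_def[symmetric])
    with Suc \<rho> show ?thesis by simp
  qed (use \<rho> in simp)
  have "poisson_kernel (of_real r * z) \<zeta> \<le> 18 * \<rho> / (\<rho> + dist z \<zeta>)\<^sup>2"
    using poisson_kernel_le[OF assms] by (simp add: \<rho>_def)
  also have "\<dots> \<le> 18 * \<rho> / (2 ^ k * \<rho> / 2)\<^sup>2"
    using \<rho> pos \<open>2 ^ k * \<rho> \<le> _\<close> by (intro divide_left_mono power_mono) (auto intro!: mult_pos_pos)
  also have "\<dots> = 72 / (4 ^ k * \<rho>)"
    using \<rho> by (simp add: power2_eq_square field_simps flip: power_mult_distrib)
  finally have "ennreal (poisson_kernel (of_real r * z) \<zeta>) \<le> t k"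
    using k by (simp add: \<rho>_def t_def ennreal_leI)
  also have "\<dots> \<le> (\<Sum>k. t k)"
    using sum_le_suminf[of t "{k}"] by simp
  finally show ?thesis
    by (simp add: t_def)
qed

lemma nn_integral_poisson_kernel_le_maximal:
  assumes \<mu>: "sets \<mu> = sets circ_m" "AE \<zeta> in \<mu>. norm \<zeta> = 1" and z: "norm z = 1" and r: "0 \<le> r" "r < 1"
  shows "(\<integral>\<^sup>+\<zeta>. ennreal (poisson_kernel (of_real r * z) \<zeta>) \<partial>\<mu>) \<le> 144 * maximal \<mu> z"
proof -
  define a where "a k = ennreal (72 / (4 ^ k * (1 - r)))" for k :: nat
  have [measurable]: "cball z \<rho> \<in> sets \<mu>" for \<rho>
    unfolding \<mu>(1) by (intro borel_sets_circ_m) auto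
  have "(\<integral>\<^sup>+\<zeta>. ennreal (poisson_kernel (of_real r * z) \<zeta>) \<partial>\<mu>)
    \<le> (\<integral>\<^sup>+\<zeta>. (\<Sum>k. a k * indicator (cball z (2 ^ k * (1 - r))) \<zeta>) \<partial>\<mu>)"
    unfolding a_def using \<mu>(2)
    by (intro nn_integral_mono_AE) (auto elim!: eventually_mono intro: poisson_kernel_le_dyadic z r)
  also have "\<dots> = (\<Sum>k. \<integral>\<^sup>+\<zeta>. a k * indicator (cball z (2 ^ k * (1 - r))) \<zeta> \<partial>\<mu>)"
    by (rule nn_integral_suminf) measurable
  also have "\<dots> = (\<Sum>k. a k * emeasure \<mu> (cball z (2 ^ k * (1 - r))))"
    by (simp add: nn_integral_cmult)
  also have "\<dots> \<le> (\<Sum>k. a k * (maximal \<mu> z * ennreal (2 ^ k * (1 - r))))"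
    using r by (intro suminf_le mult_left_mono emeasure_cball_le_maximal) auto
  also have "\<dots> = (\<Sum>k. maximal \<mu> z * ennreal (72 * (1 / 2) ^ k))"
  proof (rule suminf_cong)
    fix k :: nat
    have "72 / (4 ^ k * (1 - r)) * (2 ^ k * (1 - r)) = 72 * (2 ^ k / 4 ^ k)"
      using r by simp
    also have "(2::real) ^ k / 4 ^ k = (1 / 2) ^ k"
      by (simp flip: power_divide)
    finally have "a k * ennreal (2 ^ k * (1 - r)) = ennreal (72 * (1 / 2) ^ k)"
      using r by (simp add: a_def flip: ennreal_mult)
    then show "a k * (maximal \<mu> z * ennreal (2 ^ k * (1 - r))) = maximal \<mu> z * ennreal (72 * (1 / 2) ^ k)"
      by (metis mult.left_commute)
  qed
  also have "\<dots> = maximal \<mu> z * (\<Sum>k. ennreal (72 * (1 / 2) ^ k))"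
    by (rule ennreal_suminf_cmult)
  also have "(\<Sum>k. ennreal (72 * (1 / 2) ^ k)) = ennreal (72 * 2)"
    using sums_mult[OF geometric_sums[of "1/2::real"], of 72] by (intro suminf_ennreal_eq) auto
  finally show ?thesis
    by (simp add: mult.commute)
qed

lemma poisson_le_maximal:
  assumes f: "integrable circ_m f" "\<And>\<zeta>. 0 \<le> f \<zeta>" and z: "norm z = 1" and r: "0 \<le> r" "r < 1"
  shows "ennreal (poisson f (of_real r * z)) \<le> 144 * maximal (density circ_m f) z"
proof -
  let ?w = "of_real r * z"
  have w: "norm ?w < 1"
    using z r by (simp add: norm_mult)
  note kernel_nonneg = less_imp_le[OF poisson_kernel_pos[OF _ w]]
  have kernel: "poisson_kernel ?w \<in> borel_measurable circ_m"
    using integrable_poisson_kernel[OF w] by simp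
  have "ennreal (poisson f ?w) = (\<integral>\<^sup>+\<zeta>. ennreal (poisson_kernel ?w \<zeta> * f \<zeta>) \<partial>circ_m)"
    unfolding poisson_eq_integral[OF f(1) w] using AE_circ_m_norm
    by (intro nn_integral_eq_integral[symmetric] integrable_poisson_kernel_mult[OF f(1) w])
       (auto elim!: eventually_mono simp: f kernel_nonneg)
  also have "\<dots> = (\<integral>\<^sup>+\<zeta>. ennreal (f \<zeta>) * ennreal (poisson_kernel ?w \<zeta>) \<partial>circ_m)"
    using AE_circ_m_norm
    by (intro nn_integral_cong_AE)
       (auto elim!: eventually_mono simp: f kernel_nonneg ennreal_mult mult.commute[of "poisson_kernel _ _"])
  also have "\<dots> = (\<integral>\<^sup>+\<zeta>. ennreal (poisson_kernel ?w \<zeta>) \<partial>density circ_m f)"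
    using f(1) kernel by (intro nn_integral_density[symmetric]) auto
  also have "\<dots> \<le> 144 * maximal (density circ_m f) z"
    using f(1) AE_circ_m_norm
    by (intro nn_integral_poisson_kernel_le_maximal z r) (auto simp: AE_density elim: eventually_mono)
  finally show ?thesis .
qed

lemma poisson_tendsto_0_away:
  assumes f: "integrable circ_m f" and z: "norm z = 1" and d: "0 < d" "\<And>\<zeta>. dist z \<zeta> < d \<Longrightarrow> f \<zeta> = 0"
  shows "((\<lambda>r. poisson f (of_real r * z)) \<longlongrightarrow> 0) (at_left 1)"
proof (rule Lim_null_comparison)
  have "((\<lambda>r::real. 18 * (1 - r) / d\<^sup>2 * (LINT \<zeta>|circ_m. \<bar>f \<zeta>\<bar>))
      \<longlongrightarrow> 18 * (1 - 1) / d\<^sup>2 * (LINT \<zeta>|circ_m. \<bar>f \<zeta>\<bar>)) (at_left 1)"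
    by (intro tendsto_intros) (use d in auto)
  then show "((\<lambda>r::real. 18 * (1 - r) / d\<^sup>2 * (LINT \<zeta>|circ_m. \<bar>f \<zeta>\<bar>)) \<longlongrightarrow> 0) (at_left 1)"
    by simp
  have "norm (poisson f (of_real r * z)) \<le> 18 * (1 - r) / d\<^sup>2 * (LINT \<zeta>|circ_m. \<bar>f \<zeta>\<bar>)"
    if r: "0 < r" "r < 1" and w: "norm (of_real r * z) < 1" for r
  proof -
    have kernel: "norm (poisson_kernel (of_real r * z) \<zeta> * f \<zeta>) \<le> 18 * (1 - r) / d\<^sup>2 * \<bar>f \<zeta>\<bar>"
      if \<zeta>: "norm \<zeta> = 1" for \<zeta>
    proof (cases "dist z \<zeta> < d")
      case False
      have "poisson_kernel (of_real r * z) \<zeta> \<le> 18 * (1 - r) / (1 - r + dist z \<zeta>)\<^sup>2"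
        using r by (intro poisson_kernel_le \<zeta> z) auto
      also have "\<dots> \<le> 18 * (1 - r) / d\<^sup>2"
        using False r d(1) by (intro frac_le power_mono) auto
      finally show ?thesis
        using poisson_kernel_pos[OF \<zeta> w] unfolding real_norm_def abs_mult by (intro mult_right_mono) auto
    qed (simp add: d)
    have "norm (poisson f (of_real r * z))
        \<le> (LINT \<zeta>|circ_m. norm (poisson_kernel (of_real r * z) \<zeta> * f \<zeta>))"
      unfolding poisson_eq_integral[OF f w] by (rule integral_norm_bound)
    also have "\<dots> \<le> (LINT \<zeta>|circ_m. 18 * (1 - r) / d\<^sup>2 * \<bar>f \<zeta>\<bar>)"
      using f AE_circ_m_norm integrable_norm[OF integrable_poisson_kernel_mult[OF f w]]
      by (intro integral_mono_AE) (auto elim!: eventually_mono dest: kernel)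
    finally show ?thesis by simp
  qed
  then show "\<forall>\<^sub>F r in at_left 1. norm (poisson f (of_real r * z))
      \<le> 18 * (1 - r) / d\<^sup>2 * (LINT \<zeta>|circ_m. \<bar>f \<zeta>\<bar>)"
    using eventually_dilate_in_disk[OF z] by (auto elim!: eventually_mono)
qed

lemma eventually_poisson_less_if_maximal_le:
  assumes h: "integrable circ_m h" "\<And>\<zeta>. 0 \<le> h \<zeta>" and z: "norm z = 1" and U: "open U" "z \<in> U"
    and max: "maximal (density circ_m (\<lambda>\<zeta>. ennreal (h \<zeta> * indicator U \<zeta>))) z \<le> ennreal \<epsilon>"
    and \<epsilon>: "0 \<le> \<epsilon>" "144 * \<epsilon> < e"
  shows "eventually (\<lambda>r. poisson h (of_real r * z) < e) (at_left 1)"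
proof -
  define near where "near \<zeta> = h \<zeta> * indicator U \<zeta>" for \<zeta>
  define far where "far \<zeta> = h \<zeta> * indicator (- U) \<zeta>" for \<zeta>
  have "U \<in> sets circ_m" "- U \<in> sets circ_m"
    using U(1) by (auto intro!: borel_sets_circ_m)
  then have int: "integrable circ_m near" "integrable circ_m far"
    unfolding near_def far_def using h(1) by (auto intro: integrable_real_mult_indicator)
  have h_eq: "h = (\<lambda>\<zeta>. near \<zeta> + far \<zeta>)"
    by (auto simp: near_def far_def indicator_def)
  obtain d where d: "0 < d" "ball z d \<subseteq> U"
    using U by (meson openE)
  have "((\<lambda>r. poisson far (of_real r * z)) \<longlongrightarrow> 0) (at_left 1)"
    using d by (intro poisson_tendsto_0_away[OF int(2) z d(1)]) (auto simp: far_def indicator_def)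
  then have "eventually (\<lambda>r. poisson far (of_real r * z) < e - 144 * \<epsilon>) (at_left 1)"
    using \<epsilon>(2) by (intro order_tendstoD) auto
  then show ?thesis
    using eventually_dilate_in_disk[OF z]
  proof eventually_elim
    case (elim r)
    have "ennreal (poisson near (of_real r * z)) \<le> 144 * maximal (density circ_m near) z"
      using elim(2) by (intro poisson_le_maximal int z) (auto simp: near_def h)
    also have "\<dots> \<le> ennreal (144 * \<epsilon>)"
      using max \<epsilon>(1) by (simp add: near_def ennreal_mult mult_left_mono)
    finally have "poisson near (of_real r * z) \<le> 144 * \<epsilon>"
      using \<epsilon>(1) by (simp add: ennreal_le_iff)
    moreover have "poisson h (of_real r * z) = poisson near (of_real r * z) + poisson far (of_real r * z)"
      unfolding h_eq using elim(2) by (subst herglotz_add[OF int]) auto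
    ultimately show ?case
      using elim(1) by linarith
  qed
qed

text \<open>Outer regularity gives an open set \<open>U\<close> that carries the zeros of \<open>h\<close> but little of its mass. At
  points of \<open>U\<close> the part of \<open>h\<close> outside \<open>U\<close> has no influence on the radial limit, and the part inside
  is controlled by its maximal function.\<close>

lemma maximal_small_near_zero_set:
  assumes h: "integrable circ_m h" "\<And>\<zeta>. 0 \<le> h \<zeta>" and "0 < \<epsilon>" "0 < \<delta>"
  obtains U B where "open U" "AE z in circ_m. h z = 0 \<longrightarrow> z \<in> U"
    "B \<in> sets circ_m" "emeasure circ_m B \<le> ennreal \<delta>"
    "\<And>z. norm z = 1 \<Longrightarrow> z \<notin> B \<Longrightarrow>
      maximal (density circ_m (\<lambda>\<zeta>. ennreal (h \<zeta> * indicator U \<zeta>))) z \<le> ennreal \<epsilon>"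
proof -
  have "(\<integral>\<^sup>+\<zeta>. ennreal (h \<zeta>) \<partial>circ_m) < \<infinity>"
    using h by (simp add: nn_integral_eq_integral)
  then obtain U where U: "open U" "AE \<zeta> in circ_m. ennreal (h \<zeta>) = 0 \<longrightarrow> \<zeta> \<in> U"
    "(\<integral>\<^sup>+\<zeta>. ennreal (h \<zeta>) * indicator U \<zeta> \<partial>circ_m) < ennreal (\<epsilon> * \<delta> / 20)"
    using open_superset_zero_set[of circ_borel "\<lambda>\<zeta>. ennreal (h \<zeta>)" "ennreal (\<epsilon> * \<delta> / 20)"]
      h \<open>0 < \<epsilon>\<close> \<open>0 < \<delta>\<close> unfolding circ_m_eq_completion by auto
  define \<mu> where "\<mu> = density circ_m (\<lambda>\<zeta>. ennreal (h \<zeta> * indicator U \<zeta>))"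
  have U_sets: "U \<in> sets circ_m"
    using U(1) by (auto intro: borel_sets_circ_m)
  have "emeasure \<mu> UNIV = (\<integral>\<^sup>+\<zeta>. ennreal (h \<zeta>) * indicator U \<zeta> \<partial>circ_m)"
    unfolding \<mu>_def using h U_sets borel_sets_circ_m[of UNIV]
    by (subst emeasure_density) (auto simp: indicator_def intro!: nn_integral_cong)
  with U(3) have \<mu>_less: "emeasure \<mu> UNIV < ennreal (\<epsilon> * \<delta> / 20)"
    by simp
  obtain B where B: "B \<in> sets circ_m" "{z \<in> sphere 0 1. ennreal \<epsilon> < maximal \<mu> z} \<subseteq> B"
    "emeasure circ_m B \<le> ennreal (20 / \<epsilon>) * emeasure \<mu> UNIV"
    using maximal_weak_type[of \<mu> \<epsilon>] \<open>0 < \<epsilon>\<close> less_trans[OF \<mu>_less ennreal_less_top] by (auto simp: \<mu>_def)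
  note B(3)
  also have "ennreal (20 / \<epsilon>) * emeasure \<mu> UNIV \<le> ennreal (20 / \<epsilon>) * ennreal (\<epsilon> * \<delta> / 20)"
    using \<mu>_less by (intro mult_left_mono) auto
  also have "\<dots> = ennreal \<delta>"
    using \<open>0 < \<epsilon>\<close> \<open>0 < \<delta>\<close> by (simp flip: ennreal_mult)
  finally have "emeasure circ_m B \<le> ennreal \<delta>" .
  moreover have "maximal \<mu> z \<le> ennreal \<epsilon>" if "norm z = 1" "z \<notin> B" for z
    using B(2) that by (auto simp: not_less)
  ultimately show ?thesis
    using that[OF U(1) _ B(1)] U(2) h(2) by (simp add: \<mu>_def ennreal_eq_0_iff antisym_conv)
qed

lemma AE_poisson_eventually_less_on_zero_set:
  assumes h: "integrable circ_m h" "\<And>\<zeta>. 0 \<le> h \<zeta>" and "0 < e"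
  shows "AE z in circ_m. h z = 0 \<longrightarrow> eventually (\<lambda>r. poisson h (of_real r * z) < e) (at_left 1)"
proof (rule AE_if_small_exceptional_sets)
  fix \<delta> :: real assume "0 < \<delta>"
  define \<epsilon> where "\<epsilon> = e / 288"
  have \<epsilon>: "0 < \<epsilon>" "144 * \<epsilon> < e"
    using \<open>0 < e\<close> by (simp_all add: \<epsilon>_def)
  obtain U B where U: "open U" "AE z in circ_m. h z = 0 \<longrightarrow> z \<in> U"
    and B: "B \<in> sets circ_m" "emeasure circ_m B \<le> ennreal \<delta>"
    and small: "\<And>z. norm z = 1 \<Longrightarrow> z \<notin> B \<Longrightarrow>
      maximal (density circ_m (\<lambda>\<zeta>. ennreal (h \<zeta> * indicator U \<zeta>))) z \<le> ennreal \<epsilon>"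
    using maximal_small_near_zero_set[OF h \<epsilon>(1) \<open>0 < \<delta>\<close>] by blast
  have "AE z in circ_m. z \<notin> B \<longrightarrow> h z = 0 \<longrightarrow> eventually (\<lambda>r. poisson h (of_real r * z) < e) (at_left 1)"
    using U(2) AE_circ_m_norm
  proof eventually_elim
    case (elim z)
    show ?case
      using elim \<epsilon> by (intro impI eventually_poisson_less_if_maximal_le[OF h _ U(1) _ small]) auto
  qed
  with B show "\<exists>B\<in>sets circ_m. emeasure circ_m B \<le> ennreal \<delta> \<and> (AE z in circ_m. z \<notin> B \<longrightarrow>
      h z = 0 \<longrightarrow> eventually (\<lambda>r. poisson h (of_real r * z) < e) (at_left 1))"
    by blast
qed

lemma AE_poisson_tendsto_0_on_zero_set:
  assumes h: "integrable circ_m h" "\<And>\<zeta>. 0 \<le> h \<zeta>"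
  shows "AE z in circ_m. h z = 0 \<longrightarrow> ((\<lambda>r. poisson h (of_real r * z)) \<longlongrightarrow> 0) (at_left 1)"
proof -
  have "AE z in circ_m. \<forall>n::nat. h z = 0 \<longrightarrow>
      eventually (\<lambda>r. poisson h (of_real r * z) < 1 / Suc n) (at_left 1)"
    unfolding AE_all_countable by (intro allI AE_poisson_eventually_less_on_zero_set h) simp
  with AE_circ_m_norm show ?thesis
  proof eventually_elim
    case (elim z)
    have nonneg: "eventually (\<lambda>r. 0 \<le> poisson h (of_real r * z)) (at_left 1)"
      using eventually_dilate_in_disk[OF elim(1)] by eventually_elim (simp add: poisson_nonneg h)
    show ?case
    proof (intro impI order_tendstoI)
      fix y :: real assume "h z = 0" "0 < y"
      then obtain n where "1 / real (Suc n) < y"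
        using nat_approx_posE by blast
      with elim(2) \<open>h z = 0\<close> show "eventually (\<lambda>r. poisson h (of_real r * z) < y) (at_left 1)"
        by (auto elim!: eventually_mono dest: spec[of _ n])
    qed (use nonneg in \<open>auto elim!: eventually_mono intro: less_le_trans\<close>)
  qed
qed

lemma AE_poisson_eventually_less:
  assumes f: "integrable circ_m f"
  shows "AE z in circ_m. \<forall>y>f z. eventually (\<lambda>r. poisson f (of_real r * z) < y) (at_left 1)"
proof -
  have "AE z in circ_m. \<forall>c::rat. max 0 (f z - of_rat c) = 0 \<longrightarrow>
      ((\<lambda>r. poisson (\<lambda>\<zeta>. max 0 (f \<zeta> - of_rat c)) (of_real r * z)) \<longlongrightarrow> 0) (at_left 1)"
    unfolding AE_all_countable using f by (intro allI AE_poisson_tendsto_0_on_zero_set) auto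
  with AE_circ_m_norm show ?thesis
  proof eventually_elim
    case (elim z)
    show ?case
    proof (intro allI impI)
      fix y assume "f z < y"
      then obtain c where c: "f z < of_rat c" "of_rat c < y"
        using of_rat_dense by blast
      define g where "g \<zeta> = max 0 (f \<zeta> - of_rat c)" for \<zeta>
      have g: "integrable circ_m g"
        unfolding g_def using f by auto
      have "((\<lambda>r. poisson g (of_real r * z)) \<longlongrightarrow> 0) (at_left 1)"
        unfolding g_def using elim(2) c(1) by auto
      then have "eventually (\<lambda>r. poisson g (of_real r * z) < y - of_rat c) (at_left 1)"
        using c(2) by (intro order_tendstoD) auto
      then show "eventually (\<lambda>r. poisson f (of_real r * z) < y) (at_left 1)"
        using eventually_dilate_in_disk[OF elim(1)]
      proof eventually_elim
        case (elim r)
        then have w: "norm (of_real r * z) < 1"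
          by simp
        have "poisson f (of_real r * z) \<le> poisson (\<lambda>\<zeta>. of_rat c + g \<zeta>) (of_real r * z)"
          using f g w by (intro poisson_mono) (auto simp: g_def)
        also have "\<dots> = of_rat c + poisson g (of_real r * z)"
          using g w by (simp add: herglotz_add poisson_const)
        finally show ?case
          using elim(1) by linarith
      qed
    qed
  qed
qed

theorem Fatou_radial_limit:
  assumes f: "integrable circ_m f"
  shows "AE z in circ_m. ((\<lambda>r. poisson f (of_real r * z)) \<longlongrightarrow> f z) (at_left 1)"
  using AE_poisson_eventually_less[OF f] AE_poisson_eventually_less[OF integrable_minus[OF f]]
proof eventually_elim
  case (elim z)
  show ?case
  proof (rule order_tendstoI)
    fix y assume "y < f z"
    with elim(2) have "eventually (\<lambda>r. poisson (\<lambda>\<zeta>. - f \<zeta>) (of_real r * z) < - y) (at_left 1)"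
      by simp
    then show "eventually (\<lambda>r. y < poisson f (of_real r * z)) (at_left 1)"
      by (simp add: herglotz_minus)
  qed (use elim(1) in blast)
qed

section \<open>Conjugate functions and L log L\<close>

lemma half_le_mult_arctan:
  fixes s :: real
  assumes "0 \<le> s"
  shows "s / 2 - 2 \<le> s * arctan s - ln (1 + s)"
proof (cases "s \<le> 1")
  case True
  have "0 \<le> s * arctan s" "ln (1 + s) \<le> s"
    using assms by (simp_all add: ln_add_one_self_le_self)
  with True show ?thesis
    by linarith
next
  case False
  have "arctan 1 \<le> arctan s"
    using False by (simp only: arctan_le_iff)
  then have "3 / 4 \<le> arctan s"
    using pi_gt3 by (simp add: arctan_one)
  then have "s * (3 / 4) \<le> s * arctan s"
    using assms by (rule mult_left_mono)
  moreover have "ln (1 + s) = ln ((1 + s) / 4) + 2 * ln 2"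
    using ln_realpow[of 2 2] assms by (simp add: ln_div)
  moreover have "ln ((1 + s) / 4) \<le> (1 + s) / 4 - 1" "ln 2 \<le> 2 - (1::real)"
    using assms by (intro ln_le_minus_one; simp)+
  ultimately show ?thesis
    by (simp add: add_divide_distrib)
qed

lemma abs_Im_le_Re_mult_Ln:
  assumes "0 < Re g"
  shows "\<bar>Im g\<bar> \<le> 2 * (Re g * ln (Re g) - Re (g * Ln g)) + 4 * Re g"
proof -
  define s where "s = Im g / Re g"
  have g: "g \<noteq> 0" and Im_g: "Im g = Re g * s"
    using assms by (auto simp: s_def)
  have "norm g \<le> Re g * (1 + \<bar>s\<bar>)"
    using cmod_le[of g] assms by (simp add: Im_g abs_mult distrib_left)
  then have "ln (norm g) \<le> ln (Re g) + ln (1 + \<bar>s\<bar>)"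
    using assms g by (simp flip: ln_mult_pos)
  then have "Re g * ln (norm g) \<le> Re g * (ln (Re g) + ln (1 + \<bar>s\<bar>))"
    using assms by (intro mult_left_mono) auto
  moreover have "Im (Ln g) = arctan s"
    using assms g by (simp add: Im_Ln_eq s_def)
  then have "Re (g * Ln g) = Re g * ln (norm g) - Re g * (s * arctan s)"
    using g by (simp add: Im_g)
  moreover have "\<bar>s\<bar> * arctan \<bar>s\<bar> = s * arctan s"
    by (simp add: abs_if arctan_minus)
  then have "Re g * (\<bar>s\<bar> / 2 - 2) \<le> Re g * (s * arctan s - ln (1 + \<bar>s\<bar>))"
    using half_le_mult_arctan[of "\<bar>s\<bar>"] assms by (intro mult_left_mono) auto
  moreover have "\<bar>Im g\<bar> = Re g * \<bar>s\<bar>"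
    using assms by (simp add: Im_g abs_mult)
  ultimately show ?thesis
    by (simp add: algebra_simps)
qed

lemma Re_mult_ln_le_Re_mult_Ln:
  assumes "0 < Re g"
  shows "Re g * ln (Re g) \<le> Re (g * Ln g) + pi / 2 * \<bar>Im g\<bar>"
proof -
  have "g \<noteq> 0"
    using assms by auto
  have "Re g * ln (Re g) \<le> Re g * ln (norm g)"
    using assms complex_Re_le_cmod[of g] by (intro mult_left_mono ln_mono) auto
  moreover have "Im g * Im (Ln g) \<le> \<bar>Im (Ln g)\<bar> * \<bar>Im g\<bar>"
    by (simp add: mult.commute flip: abs_mult)
  moreover have "\<bar>Im (Ln g)\<bar> * \<bar>Im g\<bar> \<le> pi / 2 * \<bar>Im g\<bar>"
    using Re_Ln_pos_lt_imp[OF assms] by (intro mult_right_mono) auto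
  ultimately show ?thesis
    using \<open>g \<noteq> 0\<close> by simp
qed

definition LlogL_young :: "real \<Rightarrow> real" where
  "LlogL_young x = (1 + x) * ln (1 + x)"

lemma LlogL_young_nonneg: "0 \<le> x \<Longrightarrow> 0 \<le> LlogL_young x"
  by (simp add: LlogL_young_def)

lemma borel_measurable_LlogL_young [measurable]: "LlogL_young \<in> borel_measurable borel"
  unfolding LlogL_young_def[abs_def] by measurable

lemma LlogL_young_mono: "0 \<le> x \<Longrightarrow> x \<le> y \<Longrightarrow> LlogL_young x \<le> LlogL_young y"
  unfolding LlogL_young_def by (intro mult_mono) auto

lemma convex_on_LlogL_young: "convex_on {-1<..} LlogL_young"
proof (rule f''_ge0_imp_convex)
  show "(LlogL_young has_real_derivative 1 + ln (1 + x)) (at x)" if "x \<in> {-1<..}" for x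
    unfolding LlogL_young_def[abs_def] using that by (auto intro!: derivative_eq_intros)
  show "((\<lambda>x. 1 + ln (1 + x)) has_real_derivative 1 / (1 + x)) (at x)" if "x \<in> {-1<..}" for x :: real
    using that by (auto intro!: derivative_eq_intros)
qed auto

lemma mult_ln_le_LlogL_young:
  assumes "0 \<le> x"
  shows "x * max 0 (ln x) \<le> LlogL_young x"
  using assms by (cases "x = 0") (auto simp: LlogL_young_def intro!: mult_mono)

lemma LlogL_young_mult_le:
  assumes x: "0 \<le> x" and c: "1 \<le> c"
  shows "LlogL_young (c * x) \<le> ln (2 * c) + (c * ln (2 * c) + 1) * x + c * (x * max 0 (ln x))"
proof -
  have "c * x \<le> c * max 1 x" "1 \<le> c * max 1 x"
    using mult_left_mono[of x "max 1 x" c] mult_mono[of 1 c 1 "max 1 x"] c by auto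
  then have "1 + c * x \<le> 2 * c * max 1 x"
    by linarith
  then have "ln (1 + c * x) \<le> ln (2 * c * max 1 x)"
    using x c by (intro ln_mono) (auto intro: add_pos_nonneg)
  also have "\<dots> = ln (2 * c) + max 0 (ln x)"
    using c x by (cases "x = 0") (auto simp: ln_mult max_def)
  finally have "LlogL_young (c * x) \<le> (1 + c * x) * (ln (2 * c) + max 0 (ln x))"
    unfolding LlogL_young_def using x c by (intro mult_left_mono) auto
  also have "max 0 (ln x) \<le> x"
    using x ln_le_minus_one[of x] by (cases "x = 0") auto
  then have "(1 + c * x) * (ln (2 * c) + max 0 (ln x))
      \<le> ln (2 * c) + (c * ln (2 * c) + 1) * x + c * (x * max 0 (ln x))"
    by (simp add: algebra_simps)
  finally show ?thesis .
qed

lemma LlogL_imp_integrable_LlogL_young: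
  assumes v: "integrable circ_m v" "\<And>\<zeta>. 0 \<le> v \<zeta>" and "LlogL v" and "0 \<le> c"
  shows "integrable circ_m (\<lambda>\<zeta>. LlogL_young (c * v \<zeta>))"
proof -
  define C where "C = max 1 c"
  have C: "1 \<le> C" "c \<le> C"
    by (auto simp: C_def)
  have [measurable]: "v \<in> borel_measurable circ_m"
    using v by simp
  have "integrable circ_m (\<lambda>\<zeta>. v \<zeta> * max 0 (ln (v \<zeta>)))"
    using \<open>LlogL v\<close> v(2) by (intro integrableI_bounded) (auto simp: LlogL_def abs_mult)
  then have "integrable circ_m
      (\<lambda>\<zeta>. ln (2 * C) + (C * ln (2 * C) + 1) * v \<zeta> + C * (v \<zeta> * max 0 (ln (v \<zeta>))))"
    using v by auto
  then show ?thesis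
  proof (rule Bochner_Integration.integrable_bound)
    show "AE \<zeta> in circ_m. norm (LlogL_young (c * v \<zeta>))
        \<le> norm (ln (2 * C) + (C * ln (2 * C) + 1) * v \<zeta> + C * (v \<zeta> * max 0 (ln (v \<zeta>))))"
    proof (rule AE_I2)
      fix \<zeta>
      have "LlogL_young (c * v \<zeta>) \<le> LlogL_young (C * v \<zeta>)"
        using C \<open>0 \<le> c\<close> v(2) by (intro LlogL_young_mono mult_right_mono) auto
      then show "norm (LlogL_young (c * v \<zeta>))
          \<le> norm (ln (2 * C) + (C * ln (2 * C) + 1) * v \<zeta> + C * (v \<zeta> * max 0 (ln (v \<zeta>))))"
        using LlogL_young_mult_le[OF v(2) C(1), of \<zeta>] LlogL_young_nonneg[of "c * v \<zeta>"] v(2) \<open>0 \<le> c\<close>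
        by simp
    qed
  qed measurable
qed

lemma integrable_herglotz_dilate:
  assumes "integrable circ_m f" "\<bar>r\<bar> < 1"
  shows "integrable circ_m (\<lambda>\<zeta>. herglotz f (of_real r * \<zeta>))"
  by (intro dilate_integrable herglotz_holomorphic assms)

lemma herglotz_dilate_mean:
  assumes "integrable circ_m f" "\<bar>r\<bar> < 1"
  shows "(LINT \<zeta>|circ_m. poisson f (of_real r * \<zeta>)) = (LINT \<zeta>|circ_m. f \<zeta>)"
    and "(LINT \<zeta>|circ_m. conj_poisson f (of_real r * \<zeta>)) = 0"
  using dilate_mean_value[OF herglotz_holomorphic, OF assms] herglotz_0[OF assms(1)]
    integrable_herglotz_dilate[OF assms]
  by (simp_all add: integral_Re integral_Im)

definition conj_L1_mean :: "(complex \<Rightarrow> real) \<Rightarrow> real \<Rightarrow> real" where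
  "conj_L1_mean f r = (LINT \<zeta>|circ_m. \<bar>conj_poisson f (of_real r * \<zeta>)\<bar>)"

lemma conj_L1_mean_cmult: "0 \<le> c \<Longrightarrow> conj_L1_mean (\<lambda>\<zeta>. c * f \<zeta>) r = c * conj_L1_mean f r"
  by (simp add: conj_L1_mean_def herglotz_cmult abs_mult)

definition zygmund :: "(complex \<Rightarrow> real) \<Rightarrow> complex \<Rightarrow> complex" where
  "zygmund v z = (1 + herglotz v z) * Ln (1 + herglotz v z)"

lemma
  assumes v: "integrable circ_m v" "\<And>\<zeta>. 0 \<le> v \<zeta>" and r: "\<bar>r\<bar> < 1"
  shows integrable_zygmund_dilate: "integrable circ_m (\<lambda>\<zeta>. zygmund v (of_real r * \<zeta>))"
    and Re_zygmund_dilate_mean: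
      "(LINT \<zeta>|circ_m. Re (zygmund v (of_real r * \<zeta>))) = LlogL_young (LINT \<zeta>|circ_m. v \<zeta>)"
proof -
  have "1 + herglotz v z \<notin> \<real>\<^sub>\<le>\<^sub>0" if "norm z < 1" for z
    using poisson_nonneg[OF v that] by (auto simp: complex_nonpos_Reals_iff)
  then have holo: "zygmund v holomorphic_on ball 0 1"
    unfolding zygmund_def by (intro holomorphic_intros herglotz_holomorphic v) auto
  show int: "integrable circ_m (\<lambda>\<zeta>. zygmund v (of_real r * \<zeta>))"
    by (rule dilate_integrable[OF holo r])
  have v0: "0 \<le> (LINT \<zeta>|circ_m. v \<zeta>)"
    using v(2) by simp
  have "1 + herglotz v 0 = of_real (1 + (LINT \<zeta>|circ_m. v \<zeta>))"
    using herglotz_0[OF v(1)] by simp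
  then have "zygmund v 0 = of_real (LlogL_young (LINT \<zeta>|circ_m. v \<zeta>))"
    unfolding zygmund_def LlogL_young_def using v0 by (simp only:) (simp only: Ln_of_real of_real_mult)
  then show "(LINT \<zeta>|circ_m. Re (zygmund v (of_real r * \<zeta>))) = LlogL_young (LINT \<zeta>|circ_m. v \<zeta>)"
    using dilate_mean_value[OF holo r] int by (simp add: integral_Re)
qed

lemma conj_L1_mean_le:
  assumes v: "integrable circ_m v" "\<And>\<zeta>. 0 \<le> v \<zeta>" and \<Phi>v: "integrable circ_m (\<lambda>\<zeta>. LlogL_young (v \<zeta>))"
    and r: "\<bar>r\<bar> < 1"
  shows "conj_L1_mean v r \<le> 2 * (LINT \<zeta>|circ_m. LlogL_young (v \<zeta>)) + 4 * (1 + (LINT \<zeta>|circ_m. v \<zeta>))"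
proof -
  define bound where "bound \<zeta> = 2 * (poisson (\<lambda>\<zeta>. LlogL_young (v \<zeta>)) (of_real r * \<zeta>)
    - Re (zygmund v (of_real r * \<zeta>))) + 4 * (1 + poisson v (of_real r * \<zeta>))" for \<zeta>
  have v_range: "AE \<zeta> in circ_m. v \<zeta> \<in> {-1<..}"
    using v(2) by (intro AE_I2) (simp add: less_le_trans[of _ 0])
  note int = integrable_herglotz_dilate[OF v(1) r] integrable_herglotz_dilate[OF \<Phi>v r]
    integrable_zygmund_dilate[OF v r]
  have "conj_L1_mean v r \<le> (LINT \<zeta>|circ_m. bound \<zeta>)"
    unfolding conj_L1_mean_def
  proof (rule integral_mono_AE)
    show "AE \<zeta> in circ_m. \<bar>conj_poisson v (of_real r * \<zeta>)\<bar> \<le> bound \<zeta>"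
      using AE_circ_m_norm
    proof eventually_elim
      case (elim \<zeta>)
      have z: "norm (of_real r * \<zeta>) < 1"
        using elim by (intro norm_dilate_less r) simp
      have "LlogL_young (poisson v (of_real r * \<zeta>)) \<le> poisson (\<lambda>\<zeta>. LlogL_young (v \<zeta>)) (of_real r * \<zeta>)"
        by (intro poisson_Jensen[OF v(1) v_range] \<Phi>v convex_on_LlogL_young z) auto
      then show ?case
        using abs_Im_le_Re_mult_Ln[of "1 + herglotz v (of_real r * \<zeta>)"] poisson_nonneg[OF v z]
        by (simp add: bound_def zygmund_def LlogL_young_def)
    qed
  qed (use int in \<open>auto simp: bound_def\<close>)
  also have "\<dots> = 2 * ((LINT \<zeta>|circ_m. LlogL_young (v \<zeta>)) - LlogL_young (LINT \<zeta>|circ_m. v \<zeta>))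
      + 4 * (1 + (LINT \<zeta>|circ_m. v \<zeta>))"
    unfolding bound_def using int herglotz_dilate_mean(1)[OF v(1) r] herglotz_dilate_mean(1)[OF \<Phi>v r]
      Re_zygmund_dilate_mean[OF v r] circ.prob_space by simp
  also have "\<dots> \<le> 2 * (LINT \<zeta>|circ_m. LlogL_young (v \<zeta>)) + 4 * (1 + (LINT \<zeta>|circ_m. v \<zeta>))"
    using LlogL_young_nonneg[of "LINT \<zeta>|circ_m. v \<zeta>"] v by simp
  finally show ?thesis .
qed

lemma nn_integral_LlogL_young_poisson_le:
  assumes v: "integrable circ_m v" "\<And>\<zeta>. 0 \<le> v \<zeta>" and r: "\<bar>r\<bar> < 1"
  shows "(\<integral>\<^sup>+\<zeta>. LlogL_young (poisson v (of_real r * \<zeta>)) \<partial>circ_m)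
    \<le> ennreal (LlogL_young (LINT \<zeta>|circ_m. v \<zeta>) + pi / 2 * conj_L1_mean v r)"
proof -
  define bound where
    "bound \<zeta> = Re (zygmund v (of_real r * \<zeta>)) + pi / 2 * \<bar>conj_poisson v (of_real r * \<zeta>)\<bar>" for \<zeta>
  note int = integrable_herglotz_dilate[OF v(1) r] integrable_zygmund_dilate[OF v r]
  have bound: "integrable circ_m bound"
    unfolding bound_def using int by auto
  have le: "AE \<zeta> in circ_m. LlogL_young (poisson v (of_real r * \<zeta>)) \<le> bound \<zeta> \<and> 0 \<le> bound \<zeta>"
    using AE_circ_m_norm
  proof eventually_elim
    case (elim \<zeta>)
    have z: "norm (of_real r * \<zeta>) < 1"
      using elim by (intro norm_dilate_less r) simp
    have "LlogL_young (poisson v (of_real r * \<zeta>)) \<le> bound \<zeta>"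
      using Re_mult_ln_le_Re_mult_Ln[of "1 + herglotz v (of_real r * \<zeta>)"] poisson_nonneg[OF v z]
      by (simp add: zygmund_def LlogL_young_def bound_def)
    with LlogL_young_nonneg[OF poisson_nonneg[OF v z]] show ?case
      by simp
  qed
  have "(\<integral>\<^sup>+\<zeta>. LlogL_young (poisson v (of_real r * \<zeta>)) \<partial>circ_m) \<le> (\<integral>\<^sup>+\<zeta>. bound \<zeta> \<partial>circ_m)"
    using le by (intro nn_integral_mono_AE) (auto elim!: eventually_mono intro: ennreal_leI)
  also have "\<dots> = ennreal (LINT \<zeta>|circ_m. bound \<zeta>)"
    using le by (intro nn_integral_eq_integral bound) (auto elim: eventually_mono)
  also have "(LINT \<zeta>|circ_m. bound \<zeta>) = LlogL_young (LINT \<zeta>|circ_m. v \<zeta>) + pi / 2 * conj_L1_mean v r"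
    unfolding bound_def conj_L1_mean_def using int Re_zygmund_dilate_mean[OF v r] by simp
  finally show ?thesis .
qed

definition radius :: "nat \<Rightarrow> real" where
  "radius k = 1 - 1 / real (k + 2)"

lemma abs_radius_less [simp]: "\<bar>radius k\<bar> < 1"
  by (auto simp: radius_def field_simps abs_if)

lemma radius_at_left: "filterlim radius (at_left 1) sequentially"
proof (rule tendsto_imp_filterlim_at_left)
  have "(\<lambda>k. 1 - 1 / real (k + 2)) \<longlonglongrightarrow> 1 - 0"
    using LIMSEQ_ignore_initial_segment[OF lim_1_over_n, of 2] by (intro tendsto_intros) simp
  then show "radius \<longlonglongrightarrow> 1"
    by (simp add: radius_def[abs_def])
qed (simp add: radius_def)

lemma conj_L1_mean_bounded_imp_LlogL:
  assumes v: "integrable circ_m v" "\<And>\<zeta>. 0 \<le> v \<zeta>"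
    and C: "\<And>r. \<bar>r\<bar> < 1 \<Longrightarrow> conj_L1_mean v r \<le> C"
  shows "LlogL v"
proof -
  have "(\<integral>\<^sup>+\<zeta>. ennreal (\<bar>v \<zeta>\<bar> * max 0 (ln \<bar>v \<zeta>\<bar>)) \<partial>circ_m) \<le> (\<integral>\<^sup>+\<zeta>. ennreal (LlogL_young (v \<zeta>)) \<partial>circ_m)"
    using v(2) by (intro nn_integral_mono ennreal_leI) (simp add: mult_ln_le_LlogL_young)
  also have "\<dots> \<le> ennreal (LlogL_young (LINT \<zeta>|circ_m. v \<zeta>) + pi / 2 * C)"
  proof (rule nn_integral_le_if_AE_LIMSEQ)
    show "(\<lambda>\<zeta>. ennreal (LlogL_young (poisson v (of_real (radius k) * \<zeta>))))
        \<in> borel_measurable circ_m" for k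
      using integrable_herglotz_dilate[OF v(1), of "radius k"] by simp
    show "AE \<zeta> in circ_m. (\<lambda>k. ennreal (LlogL_young (poisson v (of_real (radius k) * \<zeta>))))
        \<longlonglongrightarrow> ennreal (LlogL_young (v \<zeta>))"
      using Fatou_radial_limit[OF v(1)]
    proof eventually_elim
      case (elim \<zeta>)
      then have "(\<lambda>k. poisson v (of_real (radius k) * \<zeta>)) \<longlonglongrightarrow> v \<zeta>"
        by (rule filterlim_compose[OF _ radius_at_left])
      then show ?case
        unfolding LlogL_young_def using v(2)[of \<zeta>] by (intro tendsto_intros) auto
    qed
    have "(\<integral>\<^sup>+\<zeta>. ennreal (LlogL_young (poisson v (of_real (radius k) * \<zeta>))) \<partial>circ_m)
      \<le> ennreal (LlogL_young (LINT \<zeta>|circ_m. v \<zeta>) + pi / 2 * C)" for k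
      by (intro order_trans[OF nn_integral_LlogL_young_poisson_le[OF v]] ennreal_leI
            add_left_mono mult_left_mono C) auto
    then show "\<forall>\<^sub>F k in sequentially.
      (\<integral>\<^sup>+\<zeta>. ennreal (LlogL_young (poisson v (of_real (radius k) * \<zeta>))) \<partial>circ_m)
      \<le> ennreal (LlogL_young (LINT \<zeta>|circ_m. v \<zeta>) + pi / 2 * C)"
      by simp
  qed
  finally show ?thesis
    using v(1) by (auto simp: LlogL_def le_less_trans)
qed

lemma abs_poisson_le:
  assumes v: "integrable circ_m v" "AE \<zeta> in circ_m. \<bar>v \<zeta>\<bar> \<le> M" and z: "norm z < 1"
  shows "\<bar>poisson v z\<bar> \<le> M"
proof -
  have "poisson v z \<le> poisson (\<lambda>_. M) z" "poisson (\<lambda>_. - M) z \<le> poisson v z"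
    using v z by (auto intro!: poisson_mono elim!: eventually_mono)
  then show ?thesis
    by (simp add: poisson_const z abs_le_iff)
qed

lemma
  assumes v: "integrable circ_m v" "\<And>\<zeta>. \<bar>v \<zeta>\<bar> \<le> M"
  shows integrable_poisson_dilate_diff_square:
      "integrable circ_m (\<lambda>\<zeta>. (poisson v (of_real (radius k) * \<zeta>) - v \<zeta>)\<^sup>2)"
    and poisson_dilate_tendsto_L2:
      "(\<lambda>k. LINT \<zeta>|circ_m. (poisson v (of_real (radius k) * \<zeta>) - v \<zeta>)\<^sup>2) \<longlonglongrightarrow> 0"
proof -
  have meas: "(\<lambda>\<zeta>. (poisson v (of_real (radius k) * \<zeta>) - v \<zeta>)\<^sup>2) \<in> borel_measurable circ_m" for k
    using v(1) integrable_herglotz_dilate[OF v(1) abs_radius_less, of k] by simp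
  have bound: "AE \<zeta> in circ_m. norm ((poisson v (of_real (radius k) * \<zeta>) - v \<zeta>)\<^sup>2) \<le> (2 * M)\<^sup>2" for k
    using AE_circ_m_norm
  proof eventually_elim
    case (elim \<zeta>)
    have "\<bar>poisson v (of_real (radius k) * \<zeta>)\<bar> \<le> M"
      using v elim by (intro abs_poisson_le norm_dilate_less) auto
    with v(2)[of \<zeta>] have "\<bar>poisson v (of_real (radius k) * \<zeta>) - v \<zeta>\<bar> \<le> \<bar>2 * M\<bar>"
      by linarith
    then show ?case
      unfolding abs_le_square_iff by simp
  qed
  show "integrable circ_m (\<lambda>\<zeta>. (poisson v (of_real (radius k) * \<zeta>) - v \<zeta>)\<^sup>2)"
    using bound meas by (rule circ.integrable_const_bound)
  have "(\<lambda>k. LINT \<zeta>|circ_m. (poisson v (of_real (radius k) * \<zeta>) - v \<zeta>)\<^sup>2) \<longlonglongrightarrow> (LINT \<zeta>|circ_m. 0)"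
  proof (rule integral_dominated_convergence[OF _ meas _ _ bound])
    show "AE \<zeta> in circ_m. (\<lambda>k. (poisson v (of_real (radius k) * \<zeta>) - v \<zeta>)\<^sup>2) \<longlonglongrightarrow> 0"
      using Fatou_radial_limit[OF v(1)]
    proof eventually_elim
      case (elim \<zeta>)
      have "(\<lambda>k. (poisson v (of_real (radius k) * \<zeta>) - v \<zeta>)\<^sup>2) \<longlonglongrightarrow> (v \<zeta> - v \<zeta>)\<^sup>2"
        by (intro tendsto_intros filterlim_compose[OF elim radius_at_left])
      then show ?case by simp
    qed
  qed auto
  then show "(\<lambda>k. LINT \<zeta>|circ_m. (poisson v (of_real (radius k) * \<zeta>) - v \<zeta>)\<^sup>2) \<longlonglongrightarrow> 0"
    by simp
qed

lemma integral_conj_poisson_diff_square_eq: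
  assumes v: "integrable circ_m v" and r: "\<bar>r\<bar> < 1" "\<bar>s\<bar> < 1"
  shows "(LINT \<zeta>|circ_m. (conj_poisson v (of_real r * \<zeta>) - conj_poisson v (of_real s * \<zeta>))\<^sup>2)
       = (LINT \<zeta>|circ_m. (poisson v (of_real r * \<zeta>) - poisson v (of_real s * \<zeta>))\<^sup>2)"
proof -
  note holo = herglotz_holomorphic[OF v]
  define D where "D \<zeta> = herglotz v (of_real r * \<zeta>) - herglotz v (of_real s * \<zeta>)" for \<zeta>
  have D: "continuous_on (cball 0 1) D" "D holomorphic_on ball 0 1"
    unfolding D_def
    by (intro continuous_intros holomorphic_intros dilate_continuous[OF holo]
        dilate_holomorphic[OF holo] r order_refl)+
  have D_circ: "continuous_on (sphere 0 1) D"
    using D(1) by (rule continuous_on_subset) auto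
  have int: "integrable circ_m (\<lambda>\<zeta>. (Im (D \<zeta>))\<^sup>2)" "integrable circ_m (\<lambda>\<zeta>. (Re (D \<zeta>))\<^sup>2)"
    "integrable circ_m (\<lambda>\<zeta>. (D \<zeta>)\<^sup>2)"
    by (intro integrable_circ_m_continuous continuous_intros D_circ)+
  \<comment> \<open>\<open>D\<^sup>2\<close> is holomorphic and vanishes at 0.\<close>
  have "(LINT \<zeta>|circ_m. (D \<zeta>)\<^sup>2) = (D 0)\<^sup>2"
    using D by (intro integral_circ_m_mean_value) (auto intro!: continuous_intros holomorphic_intros)
  then have "(LINT \<zeta>|circ_m. Re ((D \<zeta>)\<^sup>2)) = 0"
    using integral_Re[OF int(3)] by (simp add: D_def)
  then have "(LINT \<zeta>|circ_m. (Im (D \<zeta>))\<^sup>2) = (LINT \<zeta>|circ_m. (Re (D \<zeta>))\<^sup>2)"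
    using int(1,2) by (simp add: power2_eq_square)
  then show ?thesis
    by (simp add: D_def)
qed

definition conj_L1_dist :: "(complex \<Rightarrow> real) \<Rightarrow> nat \<Rightarrow> nat \<Rightarrow> real" where
  "conj_L1_dist v j k =
    (LINT \<zeta>|circ_m. \<bar>conj_poisson v (of_real (radius j) * \<zeta>) - conj_poisson v (of_real (radius k) * \<zeta>)\<bar>)"

lemma conj_L1_dist_square_le:
  assumes v: "integrable circ_m v"
  shows "(conj_L1_dist v j k)\<^sup>2
    \<le> (LINT \<zeta>|circ_m. (poisson v (of_real (radius j) * \<zeta>) - poisson v (of_real (radius k) * \<zeta>))\<^sup>2)"
proof -
  define D where "D \<zeta> =
    \<bar>conj_poisson v (of_real (radius j) * \<zeta>) - conj_poisson v (of_real (radius k) * \<zeta>)\<bar>" for \<zeta>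
  have "continuous_on (sphere 0 1) D"
    unfolding D_def
    by (intro continuous_intros dilate_continuous[OF herglotz_holomorphic[OF v]]
        abs_radius_less sphere_cball)
  then have "integrable circ_m D" "integrable circ_m (\<lambda>\<zeta>. (D \<zeta>)\<^sup>2)"
    by (intro integrable_circ_m_continuous continuous_intros; simp)+
  then have "(circ.expectation D)\<^sup>2 \<le> circ.expectation (\<lambda>\<zeta>. (D \<zeta>)\<^sup>2)"
    using circ.variance_eq[of D] circ.variance_positive[of D] by linarith
  then show ?thesis
    by (simp add: D_def[abs_def] conj_L1_dist_def integral_conj_poisson_diff_square_eq[OF v])
qed

lemma conj_L1_dist_Cauchy_bounded:
  assumes v: "integrable circ_m v" "\<And>\<zeta>. \<bar>v \<zeta>\<bar> \<le> M" and "0 < e"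
  shows "\<exists>K. \<forall>j\<ge>K. \<forall>k\<ge>K. conj_L1_dist v j k < e"
proof -
  define u where "u k \<zeta> = poisson v (of_real (radius k) * \<zeta>)" for k \<zeta>
  note int = integrable_poisson_dilate_diff_square[OF v, folded u_def]
  have u: "continuous_on (sphere 0 1) (u k)" for k
    unfolding u_def
    by (intro continuous_intros dilate_continuous[OF herglotz_holomorphic[OF v(1)]]
        abs_radius_less sphere_cball)
  have "eventually (\<lambda>k. (LINT \<zeta>|circ_m. (u k \<zeta> - v \<zeta>)\<^sup>2) < e\<^sup>2 / 4) sequentially"
    unfolding u_def using \<open>0 < e\<close> by (intro order_tendstoD(2)[OF poisson_dilate_tendsto_L2[OF v]]) simp
  then obtain K where K: "\<And>k. k \<ge> K \<Longrightarrow> (LINT \<zeta>|circ_m. (u k \<zeta> - v \<zeta>)\<^sup>2) < e\<^sup>2 / 4"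
    unfolding eventually_sequentially by blast
  have "conj_L1_dist v j k < e" if "j \<ge> K" "k \<ge> K" for j k
  proof (rule power2_less_imp_less)
    have "(conj_L1_dist v j k)\<^sup>2 \<le> (LINT \<zeta>|circ_m. (u j \<zeta> - u k \<zeta>)\<^sup>2)"
      unfolding u_def by (rule conj_L1_dist_square_le[OF v(1)])
    also have "\<dots> \<le> (LINT \<zeta>|circ_m. 2 * (u j \<zeta> - v \<zeta>)\<^sup>2 + 2 * (u k \<zeta> - v \<zeta>)\<^sup>2)"
    proof (rule integral_mono)
      fix \<zeta>
      have "0 \<le> ((u j \<zeta> - v \<zeta>) + (u k \<zeta> - v \<zeta>))\<^sup>2" by simp
      then show "(u j \<zeta> - u k \<zeta>)\<^sup>2 \<le> 2 * (u j \<zeta> - v \<zeta>)\<^sup>2 + 2 * (u k \<zeta> - v \<zeta>)\<^sup>2"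
        by (simp add: power2_eq_square algebra_simps)
    qed (use int in \<open>auto intro!: integrable_circ_m_continuous continuous_intros u\<close>)
    also have "\<dots> = 2 * (LINT \<zeta>|circ_m. (u j \<zeta> - v \<zeta>)\<^sup>2) + 2 * (LINT \<zeta>|circ_m. (u k \<zeta> - v \<zeta>)\<^sup>2)"
      using int by simp
    also have "\<dots> < e\<^sup>2"
      using K[OF that(1)] K[OF that(2)] by simp
    finally show "(conj_L1_dist v j k)\<^sup>2 < e\<^sup>2" .
  qed (use \<open>0 < e\<close> in simp)
  then show ?thesis by blast
qed

lemma LlogL_young_tail_small:
  fixes v :: "'a \<Rightarrow> real"
  assumes v: "integrable M v" "\<And>x. 0 \<le> v x" and "0 \<le> c"
    and \<Phi>v: "integrable M (\<lambda>x. LlogL_young (c * v x))" and "0 < d" "0 < e"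
  obtains b where "0 \<le> b" "(LINT x|M. max 0 (v x - b)) < d"
    "integrable M (\<lambda>x. LlogL_young (c * max 0 (v x - b)))"
    "(LINT x|M. LlogL_young (c * max 0 (v x - b))) < e"
proof -
  have v_meas: "v \<in> borel_measurable M"
    using v by simp
  have \<Phi>_meas: "(\<lambda>x. LlogL_young (c * x)) \<in> borel_measurable borel"
    by measurable
  have \<Phi>_mono: "LlogL_young (c * x) \<le> LlogL_young (c * y)" if "0 \<le> x" "x \<le> y" for x y
    using that \<open>0 \<le> c\<close> by (intro LlogL_young_mono mult_left_mono) auto
  have \<Phi>_0: "LlogL_young (c * 0) = 0"
    by (simp add: LlogL_young_def)
  have "(\<lambda>n. LINT x|M. max 0 (v x - real n)) \<longlonglongrightarrow> 0"
    using integral_tail_tendsto_0[OF v_meas v(2), of "\<lambda>x. x"] v(1) by simp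
  then have "\<forall>\<^sub>F n in sequentially. (LINT x|M. max 0 (v x - real n)) < d"
    using \<open>0 < d\<close> by (rule order_tendstoD)
  moreover have "\<forall>\<^sub>F n in sequentially. (LINT x|M. LlogL_young (c * max 0 (v x - real n))) < e"
    using integral_tail_tendsto_0[OF v_meas v(2) \<Phi>_meas \<Phi>_0 \<Phi>_mono \<Phi>v] \<open>0 < e\<close> by (rule order_tendstoD)
  ultimately have "\<forall>\<^sub>F n in sequentially. (LINT x|M. max 0 (v x - real n)) < d
      \<and> (LINT x|M. LlogL_young (c * max 0 (v x - real n))) < e"
    by (rule eventually_conj)
  then obtain n where "(LINT x|M. max 0 (v x - real n)) < d"
    "(LINT x|M. LlogL_young (c * max 0 (v x - real n))) < e"
    by (auto simp: eventually_sequentially)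
  then show ?thesis
    by (intro that[of "real n"] integrable_tail[OF v_meas v(2) \<Phi>_meas \<Phi>_0 \<Phi>_mono \<Phi>v]) auto
qed

text \<open>\<open>conj_L1_mean_le\<close> is not homogeneous: its constant term 4 becomes 4 / c when it is applied to
  c times the tail of \<open>v\<close>.\<close>

lemma conj_L1_mean_tail_small:
  assumes v: "integrable circ_m v" "\<And>\<zeta>. 0 \<le> v \<zeta>"
    and \<Phi>v: "\<And>c. 0 \<le> c \<Longrightarrow> integrable circ_m (\<lambda>\<zeta>. LlogL_young (c * v \<zeta>))" and "0 < e"
  shows "\<exists>b\<ge>0. \<forall>r. \<bar>r\<bar> < 1 \<longrightarrow> conj_L1_mean (\<lambda>\<zeta>. max 0 (v \<zeta> - b)) r < e"
proof -
  define c where "c = 8 / e"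
  have c: "0 < c"
    using \<open>0 < e\<close> by (simp add: c_def)
  have "0 < e / 16"
    using \<open>0 < e\<close> by simp
  from LlogL_young_tail_small[OF v less_imp_le[OF c] \<Phi>v[OF less_imp_le[OF c]] this zero_less_one]
  obtain b where b: "0 \<le> b" "(LINT \<zeta>|circ_m. max 0 (v \<zeta> - b)) < e / 16"
    "integrable circ_m (\<lambda>\<zeta>. LlogL_young (c * max 0 (v \<zeta> - b)))"
    "(LINT \<zeta>|circ_m. LlogL_young (c * max 0 (v \<zeta> - b))) < 1"
    by blast
  define t where "t \<zeta> = max 0 (v \<zeta> - b)" for \<zeta>
  have t: "integrable circ_m t" "0 \<le> t \<zeta>" for \<zeta>
    unfolding t_def using v by auto
  have "conj_L1_mean t r < e" if r: "\<bar>r\<bar> < 1" for r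
  proof -
    have "c * conj_L1_mean t r = conj_L1_mean (\<lambda>\<zeta>. c * t \<zeta>) r"
      using c by (simp add: conj_L1_mean_cmult)
    also have "\<dots> \<le> 2 * (LINT \<zeta>|circ_m. LlogL_young (c * t \<zeta>)) + 4 * (1 + (LINT \<zeta>|circ_m. c * t \<zeta>))"
      using t c b(3)[folded t_def] by (intro conj_L1_mean_le r) auto
    also have "\<dots> < 2 * 1 + 4 * (1 + c * (e / 16))"
      using b(2,4)[folded t_def] c by (simp add: add_strict_mono)
    also have "\<dots> = c * e"
      using \<open>0 < e\<close> by (simp add: c_def)
    finally show ?thesis using c by simp
  qed
  with b(1) show ?thesis
    by (auto simp: t_def[abs_def])
qed

lemma conj_L1_dist_le_add:
  assumes u: "integrable circ_m u" and w: "integrable circ_m w"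
  shows "conj_L1_dist (\<lambda>\<zeta>. u \<zeta> + w \<zeta>) j k
    \<le> conj_L1_dist u j k + conj_L1_mean w (radius j) + conj_L1_mean w (radius k)"
proof -
  let ?D = "\<lambda>f \<zeta>. conj_poisson f (of_real (radius j) * \<zeta>) - conj_poisson f (of_real (radius k) * \<zeta>)"
  let ?C = "\<lambda>k \<zeta>. \<bar>conj_poisson w (of_real (radius k) * \<zeta>)\<bar>"
  have uw: "integrable circ_m (\<lambda>\<zeta>. u \<zeta> + w \<zeta>)"
    using u w by simp
  note int = integrable_herglotz_dilate[OF u abs_radius_less]
    integrable_herglotz_dilate[OF w abs_radius_less]
  have "conj_L1_dist (\<lambda>\<zeta>. u \<zeta> + w \<zeta>) j k \<le> (LINT \<zeta>|circ_m. \<bar>?D u \<zeta>\<bar> + ?C j \<zeta> + ?C k \<zeta>)"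
    unfolding conj_L1_dist_def
  proof (rule integral_mono_AE)
    show "AE \<zeta> in circ_m. \<bar>?D (\<lambda>\<zeta>. u \<zeta> + w \<zeta>) \<zeta>\<bar> \<le> \<bar>?D u \<zeta>\<bar> + ?C j \<zeta> + ?C k \<zeta>"
      using AE_circ_m_norm by eventually_elim (simp add: herglotz_add[OF u w] norm_dilate_less)
  qed (use int integrable_herglotz_dilate[OF uw abs_radius_less] in auto)
  also have "\<dots> = conj_L1_dist u j k + conj_L1_mean w (radius j) + conj_L1_mean w (radius k)"
    unfolding conj_L1_dist_def conj_L1_mean_def using int by simp
  finally show ?thesis .
qed

lemma conj_L1_dist_Cauchy:
  assumes v: "integrable circ_m v" "\<And>\<zeta>. 0 \<le> v \<zeta>"
    and \<Phi>v: "\<And>c. 0 \<le> c \<Longrightarrow> integrable circ_m (\<lambda>\<zeta>. LlogL_young (c * v \<zeta>))" and "0 < e"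
  shows "\<exists>K. \<forall>j\<ge>K. \<forall>k\<ge>K. conj_L1_dist v j k < e"
proof -
  have "0 < e / 3"
    using \<open>0 < e\<close> by simp
  then obtain M where M: "0 \<le> M" "\<And>r. \<bar>r\<bar> < 1 \<Longrightarrow> conj_L1_mean (\<lambda>\<zeta>. max 0 (v \<zeta> - M)) r < e / 3"
    using conj_L1_mean_tail_small[OF v \<Phi>v] by blast
  define low where "low \<zeta> = min (v \<zeta>) M" for \<zeta>
  define high where "high \<zeta> = max 0 (v \<zeta> - M)" for \<zeta>
  have int: "integrable circ_m low" "integrable circ_m high"
    unfolding low_def high_def using v by auto
  have v_eq: "v = (\<lambda>\<zeta>. low \<zeta> + high \<zeta>)"
    by (auto simp: low_def high_def)
  have "\<bar>low \<zeta>\<bar> \<le> M" for \<zeta>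
    using v(2)[of \<zeta>] M(1) by (simp add: low_def)
  then obtain K where K: "\<And>j k. j \<ge> K \<Longrightarrow> k \<ge> K \<Longrightarrow> conj_L1_dist low j k < e / 3"
    using conj_L1_dist_Cauchy_bounded[OF int(1) _ \<open>0 < e / 3\<close>] by blast
  have "conj_L1_dist v j k < e" if "j \<ge> K" "k \<ge> K" for j k
    using conj_L1_dist_le_add[OF int, of j k] K[OF that] M(2)[OF abs_radius_less, of j]
      M(2)[OF abs_radius_less, of k] unfolding v_eq[symmetric] high_def[abs_def, symmetric] by linarith
  then show ?thesis by blast
qed

lemma conj_poisson_dilate_eq_poisson:
  assumes v: "integrable circ_m v" and r: "\<bar>r\<bar> < 1" and z: "norm z < 1"
  shows "conj_poisson v (of_real r * z) = poisson (\<lambda>\<zeta>. conj_poisson v (of_real r * \<zeta>)) z"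
proof -
  note holo = herglotz_holomorphic[OF v]
  have int: "integrable circ_m (\<lambda>\<zeta>. herglotz v (of_real r * \<zeta>) * of_real (poisson_kernel z \<zeta>))"
    by (intro integrable_circ_m_continuous continuous_intros dilate_continuous[OF holo r]
        continuous_on_poisson_kernel z sphere_cball)
  have "herglotz v (of_real r * z)
      = (LINT \<zeta>|circ_m. herglotz v (of_real r * \<zeta>) * of_real (poisson_kernel z \<zeta>))"
    by (rule poisson_kernel_reproduces[symmetric])
       (intro dilate_continuous[OF holo r] dilate_holomorphic[OF holo r] z order_refl)+
  then have "conj_poisson v (of_real r * z)
      = (LINT \<zeta>|circ_m. Im (herglotz v (of_real r * \<zeta>) * of_real (poisson_kernel z \<zeta>)))"
    using integral_Im[OF int] by simp
  then show ?thesis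
    using integrable_herglotz_dilate[OF v r] z by (simp add: poisson_eq_integral mult.commute)
qed

lemma radius_mult_tendsto: "(\<lambda>k. complex_of_real (radius k) * z) \<longlonglongrightarrow> z"
proof -
  have "radius \<longlonglongrightarrow> 1"
    using radius_at_left by (simp add: filterlim_at)
  then have "(\<lambda>k. complex_of_real (radius k) * z) \<longlonglongrightarrow> of_real 1 * z"
    by (intro tendsto_intros)
  then show ?thesis by simp
qed

lemma conj_poisson_eq_poisson:
  assumes v: "integrable circ_m v" "\<And>\<zeta>. 0 \<le> v \<zeta>"
    and \<Phi>v: "\<And>c. 0 \<le> c \<Longrightarrow> integrable circ_m (\<lambda>\<zeta>. LlogL_young (c * v \<zeta>))"
  obtains w where "integrable circ_m w" "\<And>z. norm z < 1 \<Longrightarrow> conj_poisson v z = poisson w z"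
proof -
  define f where "f k \<zeta> = conj_poisson v (of_real (radius k) * \<zeta>)" for k \<zeta>
  have f: "integrable circ_m (f k)" for k
    unfolding f_def using integrable_herglotz_dilate[OF v(1) abs_radius_less] by simp
  have "\<exists>K. \<forall>j\<ge>K. \<forall>k\<ge>K. (LINT \<zeta>|circ_m. norm (f j \<zeta> - f k \<zeta>)) < e" if "0 < e" for e
    using conj_L1_dist_Cauchy[OF v \<Phi>v that] by (simp add: conj_L1_dist_def f_def)
  from L1_Cauchy_imp_convergent[OF f this]
  obtain w where w: "integrable circ_m w" "(\<lambda>k. LINT \<zeta>|circ_m. norm (f k \<zeta> - w \<zeta>)) \<longlonglongrightarrow> 0"
    by blast
  have "conj_poisson v z = poisson w z" if z: "norm z < 1" for z
  proof (rule LIMSEQ_unique)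
    have "(\<lambda>k. herglotz v (of_real (radius k) * z)) \<longlonglongrightarrow> herglotz v z"
      using z norm_dilate_less[of z, OF _ abs_radius_less]
      by (intro radius_mult_tendsto continuous_on_tendsto_compose[OF
            holomorphic_on_imp_continuous_on[OF herglotz_holomorphic[OF v(1)]]]) auto
    then have "(\<lambda>k. conj_poisson v (of_real (radius k) * z)) \<longlonglongrightarrow> conj_poisson v z"
      by (rule tendsto_Im)
    then show "(\<lambda>k. poisson (f k) z) \<longlonglongrightarrow> conj_poisson v z"
      by (simp add: conj_poisson_dilate_eq_poisson[OF v(1) abs_radius_less z] f_def[abs_def])
    show "(\<lambda>k. poisson (f k) z) \<longlonglongrightarrow> poisson w z"
      using w by (intro tendsto_Re tendsto_herglotz_L1 f z) auto
  qed
  with w(1) show ?thesis by (rule that)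
qed

section \<open>The Smirnov class\<close>

lemma outer_exp_herglotz:
  assumes "integrable circ_m u"
  shows "outer (\<lambda>z. exp (herglotz u z))"
  unfolding outer_def herglotz_def herglotz_kernel_def
  using assms by (intro exI[of _ 1] exI[of _ u]) simp

lemma outerE:
  assumes "outer h"
  obtains c u where "norm c = 1" "integrable circ_m u" "\<And>z. norm z < 1 \<Longrightarrow> h z = c * exp (herglotz u z)"
  using assms unfolding outer_def herglotz_def herglotz_kernel_def by auto

lemma Hinf_exp:
  assumes "f holomorphic_on ball 0 1" "\<And>z. norm z < 1 \<Longrightarrow> Re (f z) \<le> C"
  shows "Hinf (\<lambda>z. exp (f z))"
  unfolding Hinf_def bounded_iff using assms by (auto intro!: holomorphic_intros exI[of _ "exp C"])

lemma smirnov_exp_herglotz: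
  assumes v: "integrable circ_m v"
    and w: "integrable circ_m w" "\<And>z. norm z < 1 \<Longrightarrow> conj_poisson v z = poisson w z"
    and F: "\<And>z. norm z < 1 \<Longrightarrow> F z = exp (\<i> * herglotz v z)"
  shows "smirnov F"
proof -
  define u where "u \<zeta> = - \<bar>w \<zeta>\<bar>" for \<zeta>
  have u: "integrable circ_m u"
    unfolding u_def using w by simp
  have u_le: "poisson u z \<le> 0" "poisson u z \<le> poisson w z" if "norm z < 1" for z
    using poisson_mono[OF u, of "\<lambda>_. 0" z] poisson_mono[OF u w(1), of z] that
    by (auto simp: u_def poisson_const)
  have "Hinf (\<lambda>z. exp (herglotz u z))"
    using u_le(1) by (intro Hinf_exp herglotz_holomorphic u)
  moreover have "Hinf (\<lambda>z. exp (\<i> * herglotz v z + herglotz u z))"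
    using u_le(2) by (intro Hinf_exp[of _ 0] holomorphic_intros herglotz_holomorphic u v) (simp add: w(2))
  moreover have "F z = exp (\<i> * herglotz v z + herglotz u z) / exp (herglotz u z)" if "z \<in> ball 0 1" for z
    using F[of z] that by (simp add: exp_add)
  ultimately show ?thesis
    unfolding smirnov_def using outer_exp_herglotz[OF u] by blast
qed

lemma exp_herglotz_radial_limit_real:
  assumes v: "integrable circ_m v"
    and w: "integrable circ_m w" "\<And>z. norm z < 1 \<Longrightarrow> conj_poisson v z = poisson w z"
    and F: "\<And>z. norm z < 1 \<Longrightarrow> F z = exp (\<i> * herglotz v z)" and sin: "AE \<zeta> in circ_m. sin (v \<zeta>) = 0"
  shows "AE \<zeta> in circ_m. \<exists>L::real. ((\<lambda>r::real. F (of_real r * \<zeta>)) \<longlongrightarrow> of_real L) (at_left 1)"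
  using Fatou_radial_limit[OF v] Fatou_radial_limit[OF w(1)] sin AE_circ_m_norm
proof eventually_elim
  case (elim \<zeta>)
  define H where "H r = Complex (poisson v (of_real r * \<zeta>)) (poisson w (of_real r * \<zeta>))" for r
  have "(H \<longlongrightarrow> Complex (v \<zeta>) (w \<zeta>)) (at_left 1)"
    unfolding H_def by (intro tendsto_Complex elim)
  then have "((\<lambda>r. exp (\<i> * H r)) \<longlongrightarrow> exp (\<i> * Complex (v \<zeta>) (w \<zeta>))) (at_left 1)"
    by (intro tendsto_intros)
  moreover have "\<forall>\<^sub>F r in at_left 1. exp (\<i> * H r) = F (of_real r * \<zeta>)"
    using eventually_dilate_in_disk[OF elim(4)]
  proof eventually_elim
    case (elim r)
    then have "H r = herglotz v (of_real r * \<zeta>)"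
      using w(2)[of "of_real r * \<zeta>"] by (simp add: H_def complex_eq_iff)
    with elim show ?case by (simp add: F)
  qed
  ultimately have "((\<lambda>r. F (of_real r * \<zeta>)) \<longlongrightarrow> exp (\<i> * Complex (v \<zeta>) (w \<zeta>))) (at_left 1)"
    by (rule Lim_transform_eventually)
  moreover have "exp (\<i> * Complex (v \<zeta>) (w \<zeta>)) = of_real (exp (- w \<zeta>) * cos (v \<zeta>))"
    using elim(3) by (simp add: complex_eq_iff Re_exp Im_exp)
  ultimately show ?case by metis
qed

lemma smirnov_imp_abs_conj_poisson_le:
  assumes "smirnov F" and F: "\<And>z. norm z < 1 \<Longrightarrow> F z = exp (\<i> * herglotz v z)"
  obtains u C where "integrable circ_m u"
    "\<And>z. norm z < 1 \<Longrightarrow> \<bar>conj_poisson v z\<bar> \<le> conj_poisson v z + 2 * C + 2 * poisson u z"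
proof -
  obtain g h where g: "Hinf g" and "outer h" and gh: "\<And>z. z \<in> ball 0 1 \<Longrightarrow> F z = g z / h z"
    using assms(1) by (auto simp: smirnov_def)
  from \<open>outer h\<close> obtain c u where c: "norm c = 1" and u: "integrable circ_m u"
    and h: "\<And>z. norm z < 1 \<Longrightarrow> h z = c * exp (herglotz u z)"
    by (rule outerE) blast
  obtain B where B: "\<And>z. norm z < 1 \<Longrightarrow> norm (g z) \<le> B"
    using g unfolding Hinf_def bounded_iff by (metis imageI mem_ball_0)
  define C where "C = ln (max 1 B)"
  have abs_u: "integrable circ_m (\<lambda>\<zeta>. \<bar>u \<zeta>\<bar>)"
    using u by simp
  show ?thesis
  proof
    fix z :: complex assume z: "norm z < 1"
    have "norm (F z) * norm (h z) = norm (g z)"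
      using gh[of z] h[OF z] c z by (auto simp: norm_divide)
    then have "exp (- conj_poisson v z + poisson u z) \<le> max 1 B"
      unfolding exp_add using B[OF z] by (simp add: F[OF z] h[OF z] norm_mult c)
    then have "- conj_poisson v z + poisson u z \<le> C"
      unfolding C_def by (subst ln_ge_iff) auto
    moreover have "poisson (\<lambda>\<zeta>. - u \<zeta>) z \<le> poisson (\<lambda>\<zeta>. \<bar>u \<zeta>\<bar>) z"
      using u z by (intro poisson_mono) auto
    moreover have "0 \<le> poisson (\<lambda>\<zeta>. \<bar>u \<zeta>\<bar>) z" "0 \<le> C"
      using abs_u z by (auto intro: poisson_nonneg simp: C_def)
    ultimately show "\<bar>conj_poisson v z\<bar> \<le> conj_poisson v z + 2 * C + 2 * poisson (\<lambda>\<zeta>. \<bar>u \<zeta>\<bar>) z"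
      by (simp add: herglotz_minus)
  qed (rule abs_u)
qed

lemma smirnov_imp_conj_L1_mean_bounded:
  assumes v: "integrable circ_m v" and "smirnov F" and F: "\<And>z. norm z < 1 \<Longrightarrow> F z = exp (\<i> * herglotz v z)"
  shows "\<exists>C. \<forall>r. \<bar>r\<bar> < 1 \<longrightarrow> conj_L1_mean v r \<le> C"
proof -
  obtain u C where u: "integrable circ_m u"
    and bound: "\<And>z. norm z < 1 \<Longrightarrow> \<bar>conj_poisson v z\<bar> \<le> conj_poisson v z + 2 * C + 2 * poisson u z"
    using smirnov_imp_abs_conj_poisson_le[OF assms(2) F] by blast
  have "conj_L1_mean v r \<le> 2 * C + 2 * (LINT \<zeta>|circ_m. u \<zeta>)" if r: "\<bar>r\<bar> < 1" for r
  proof -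
    note int = integrable_herglotz_dilate[OF v r] integrable_herglotz_dilate[OF u r]
    have "conj_L1_mean v r
      \<le> (LINT \<zeta>|circ_m. conj_poisson v (of_real r * \<zeta>) + 2 * C + 2 * poisson u (of_real r * \<zeta>))"
      unfolding conj_L1_mean_def
    proof (rule integral_mono_AE)
      show "AE \<zeta> in circ_m. \<bar>conj_poisson v (of_real r * \<zeta>)\<bar>
          \<le> conj_poisson v (of_real r * \<zeta>) + 2 * C + 2 * poisson u (of_real r * \<zeta>)"
        using AE_circ_m_norm by eventually_elim (intro bound norm_dilate_less r, simp)
    qed (use int in auto)
    also have "\<dots> = 2 * C + 2 * (LINT \<zeta>|circ_m. u \<zeta>)"
      using int herglotz_dilate_mean(2)[OF v r] herglotz_dilate_mean(1)[OF u r] circ.prob_space by simp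
    finally show ?thesis .
  qed
  then show ?thesis by blast
qed

theorem Rplus_exp_herglotz_iff:
  assumes v: "integrable circ_m v" "\<And>\<zeta>. 0 \<le> v \<zeta>" and sin: "AE \<zeta> in circ_m. sin (v \<zeta>) = 0"
    and F: "\<And>z. norm z < 1 \<Longrightarrow> F z = exp (\<i> * herglotz v z)"
  shows "Rplus F \<longleftrightarrow> LlogL v"
proof
  assume "Rplus F"
  then have "smirnov F"
    by (simp add: Rplus_def)
  then show "LlogL v"
    using smirnov_imp_conj_L1_mean_bounded[OF v(1) _ F] conj_L1_mean_bounded_imp_LlogL[OF v] by blast
next
  assume "LlogL v"
  then obtain w where w: "integrable circ_m w" "\<And>z. norm z < 1 \<Longrightarrow> conj_poisson v z = poisson w z"
    using conj_poisson_eq_poisson[OF v LlogL_imp_integrable_LlogL_young[OF v]] by blast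
  show "Rplus F"
    unfolding Rplus_def
    using smirnov_exp_herglotz[OF v(1) w F] exp_herglotz_radial_limit_real[OF v(1) w F sin] by blast
qed

section \<open>The infinite product\<close>

lemma sin_sums_pi_indicator:
  assumes "(\<lambda>n. pi * indicat_real (E n) x) sums s"
  shows "sin s = 0"
proof -
  have "sin (\<Sum>n<N. pi * indicat_real (E n) x) = 0" for N
    by (induction N) (simp_all add: sin_add indicator_def)
  moreover have "(\<lambda>N. sin (\<Sum>n<N. pi * indicat_real (E n) x)) \<longlonglongrightarrow> sin s"
    using assms unfolding sums_def by (rule tendsto_sin)
  ultimately show ?thesis
    by (simp add: LIMSEQ_const_iff)
qed

lemma integrable_circ_m_indicator:
  "A \<in> sets circ_m \<Longrightarrow> integrable circ_m (\<lambda>\<zeta>. c * indicator A \<zeta> :: real)"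
  by (simp add: circ.emeasure_eq_measure)

lemma fE_eq_exp_herglotz: "fE A z = exp (\<i> * herglotz (\<lambda>\<zeta>. pi * indicator A \<zeta>) z)"
proof -
  have "(LINT \<zeta>:A|circ_m. (\<zeta> + z) / (\<zeta> - z)) = herglotz (indicator A) z"
    unfolding set_lebesgue_integral_def herglotz_def herglotz_kernel_def
    by (intro Bochner_Integration.integral_cong) (auto simp: indicator_def)
  then show ?thesis
    by (simp add: fE_def herglotz_cmult mult.assoc)
qed

lemma norm_herglotz_indicator_le:
  assumes "A \<in> sets circ_m" "norm z < 1"
  shows "norm (herglotz (\<lambda>\<zeta>. pi * indicator A \<zeta>) z) \<le> 2 * pi / (1 - norm z) * circ.prob A"
  using norm_herglotz_le[OF integrable_circ_m_indicator, OF assms, of pi] assms(1)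
  by (simp add: abs_mult)

lemma compact_subset_ball_norm_le:
  fixes K :: "'a::real_normed_vector set"
  assumes "compact K" "K \<subseteq> ball 0 1"
  obtains R where "R < 1" "\<And>z. z \<in> K \<Longrightarrow> norm z \<le> R"
proof (cases "K = {}")
  case False
  then obtain x where "x \<in> K" "\<And>y. y \<in> K \<Longrightarrow> norm y \<le> norm x"
    using continuous_attains_sup[of K norm] assms(1) by (auto intro: continuous_intros)
  with assms(2) that[of "norm x"] show ?thesis by auto
qed (auto intro: that[of 0])

lemma prod_abs_loc_unif_fE_if_summable:
  assumes E: "\<And>n. E n \<in> sets circ_m" and summable: "summable (\<lambda>n. circ.prob (E n))"
  shows "prod_abs_loc_unif (\<lambda>n. fE (E n))"
  unfolding prod_abs_loc_unif_def
proof (intro allI impI, elim conjE)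
  fix K :: "complex set" assume "compact K" "K \<subseteq> ball 0 1"
  then obtain R where R: "R < 1" "\<And>z. z \<in> K \<Longrightarrow> norm z \<le> R"
    by (rule compact_subset_ball_norm_le) blast
  define C where "C = 2 * pi / (1 - R)"
  have "(\<lambda>n. C * circ.prob (E n)) \<longlonglongrightarrow> 0"
    by (intro tendsto_mult_right_zero summable_LIMSEQ_zero summable)
  then have "\<forall>\<^sub>F n in sequentially. C * circ.prob (E n) < 1 / 2"
    by (rule order_tendstoD) simp
  then have "\<forall>\<^sub>F n in sequentially. \<forall>z\<in>K. norm (norm (1 - fE (E n) z)) \<le> 3 / 2 * (C * circ.prob (E n))"
  proof eventually_elim
    case (elim n)
    show ?case
    proof
      fix z assume z: "z \<in> K"
      define w where "w = \<i> * herglotz (\<lambda>\<zeta>. pi * indicator (E n) \<zeta>) z"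
      have "norm w \<le> 2 * pi / (1 - norm z) * circ.prob (E n)"
        unfolding w_def norm_mult using norm_herglotz_indicator_le[OF E, of z n] R z by fastforce
      also have "\<dots> \<le> C * circ.prob (E n)"
        unfolding C_def using R z by (intro mult_right_mono frac_le) auto
      finally have w: "norm w \<le> C * circ.prob (E n)" .
      then have "norm (exp w - 1) \<le> 3 / 2 * norm w"
        using elim by (intro norm_exp_bounds) simp
      with w show "norm (norm (1 - fE (E n) z)) \<le> 3 / 2 * (C * circ.prob (E n))"
        by (simp add: fE_eq_exp_herglotz w_def norm_minus_commute)
    qed
  qed
  then show "uniformly_convergent_on K (\<lambda>N z. \<Sum>n<N. norm (1 - fE (E n) z))"
    by (rule Weierstrass_m_test'_ev) (intro summable_mult summable)
qed

lemma measure_le_norm_one_minus_fE_0: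
  assumes A: "A \<in> sets circ_m"
  shows "circ.prob A \<le> 2 * norm (1 - fE A 0)"
proof (cases "norm (1 - fE A 0) < 1 / 2")
  case True
  have fE_0: "fE A 0 = exp (\<i> * of_real (pi * circ.prob A))"
    using herglotz_0[OF integrable_circ_m_indicator[OF A], of pi] A by (simp add: fE_eq_exp_herglotz)
  have "pi * circ.prob A \<le> pi"
    using circ.prob_le_1[of A] by simp
  moreover have "- pi < pi * circ.prob A"
    by (rule less_le_trans[of _ 0]) simp_all
  ultimately have "Ln (fE A 0) = \<i> * of_real (pi * circ.prob A)"
    unfolding fE_0 by (intro Ln_exp) simp_all
  then have "pi * circ.prob A = norm (Ln (1 + (fE A 0 - 1)))"
    by (simp add: norm_mult)
  also have "\<dots> \<le> 2 * norm (1 - fE A 0)"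
    using norm_Ln_le[of "fE A 0 - 1"] True by (simp add: norm_minus_commute)
  finally have "pi * circ.prob A \<le> 2 * norm (1 - fE A 0)" .
  moreover have "1 * circ.prob A \<le> pi * circ.prob A"
    using pi_gt3 by (intro mult_right_mono) auto
  ultimately show ?thesis by simp
next
  case False
  with circ.prob_le_1[of A] show ?thesis by linarith
qed

lemma prod_abs_loc_unif_fE_iff_summable:
  assumes E: "\<And>n. E n \<in> sets circ_m"
  shows "prod_abs_loc_unif (\<lambda>n. fE (E n)) \<longleftrightarrow> summable (\<lambda>n. circ.prob (E n))"
proof
  assume "prod_abs_loc_unif (\<lambda>n. fE (E n))"
  then have "uniformly_convergent_on {0} (\<lambda>N z. \<Sum>n<N. norm (1 - fE (E n) z))"
    unfolding prod_abs_loc_unif_def by auto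
  then have "convergent (\<lambda>N. \<Sum>n<N. norm (1 - fE (E n) 0))"
    by (rule uniformly_convergent_imp_convergent) simp
  then have "summable (\<lambda>n. 2 * norm (1 - fE (E n) 0))"
    by (intro summable_mult) (simp add: summable_iff_convergent)
  then show "summable (\<lambda>n. circ.prob (E n))"
    by (rule summable_comparison_test'[where N = 0]) (simp add: measure_le_norm_one_minus_fE_0 E)
qed (intro prod_abs_loc_unif_fE_if_summable E)

lemma prodinf_fE_eq_exp_herglotz:
  assumes E: "\<And>n. E n \<in> sets circ_m" and v: "integrable circ_m v"
    and sums: "AE \<zeta> in circ_m. (\<lambda>n. pi * indicat_real (E n) \<zeta>) sums v \<zeta>" and z: "norm z < 1"
  shows "(\<Prod>n. fE (E n) z) = exp (\<i> * herglotz v z)"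
proof -
  let ?f = "\<lambda>n \<zeta>. pi * indicat_real (E n) \<zeta>"
  have f: "integrable circ_m (?f n)" for n
    by (intro integrable_circ_m_indicator E)
  have "(\<lambda>N. herglotz (\<lambda>\<zeta>. \<Sum>n<N. ?f n \<zeta>) z) \<longlonglongrightarrow> herglotz v z"
    by (intro tendsto_herglotz_L1 Bochner_Integration.integrable_sum f v z
        partial_sums_tendsto_L1[OF borel_measurable_integrable[OF f] _ v sums]) simp
  then have "(\<lambda>n. herglotz (?f n) z) sums herglotz v z"
    unfolding sums_def by (subst herglotz_sum[OF f z, symmetric])
  then have "(\<lambda>n. \<i> * herglotz (?f n) z) sums (\<i> * herglotz v z)"
    by (rule sums_mult)
  then have "(\<lambda>n. fE (E n) z) has_prod exp (\<i> * herglotz v z)"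
    unfolding fE_eq_exp_herglotz has_prod_def by (intro disjI1 sums_imp_has_prod_exp)
  then show ?thesis
    by (simp add: has_prod_iff)
qed

lemma Rplus_prodinf_fE_iff:
  fixes E :: "nat \<Rightarrow> complex set"
  assumes E[measurable]: "\<And>n. E n \<in> sets circ_m"
  defines "v \<equiv> (\<lambda>\<zeta>. \<Sum>n. ennreal (pi * indicator (E n) \<zeta>))"
  assumes fin: "(\<integral>\<^sup>+ \<zeta>. v \<zeta> \<partial>circ_m) < \<infinity>"
  shows "Rplus (\<lambda>z. \<Prod>n. fE (E n) z) \<longleftrightarrow> LlogL (\<lambda>\<zeta>. enn2real (v \<zeta>))"
proof (rule Rplus_exp_herglotz_iff)
  have [measurable]: "v \<in> borel_measurable circ_m"
    unfolding v_def by measurable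
  have finite_AE: "AE \<zeta> in circ_m. v \<zeta> \<noteq> \<infinity>"
    using fin by (intro nn_integral_PInf_AE) auto
  then have "(\<integral>\<^sup>+ \<zeta>. ennreal (enn2real (v \<zeta>)) \<partial>circ_m) = (\<integral>\<^sup>+ \<zeta>. v \<zeta> \<partial>circ_m)"
    by (intro nn_integral_cong_AE) (auto elim!: eventually_mono simp: less_top)
  with fin show int: "integrable circ_m (\<lambda>\<zeta>. enn2real (v \<zeta>))"
    by (intro integrableI_nonneg) auto
  have sums: "AE \<zeta> in circ_m. (\<lambda>n. pi * indicat_real (E n) \<zeta>) sums enn2real (v \<zeta>)"
    using finite_AE unfolding v_def by eventually_elim (rule sums_enn2real_suminf, simp_all)
  then show "AE \<zeta> in circ_m. sin (enn2real (v \<zeta>)) = 0"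
    by eventually_elim (rule sin_sums_pi_indicator)
  show "(\<Prod>n. fE (E n) z) = exp (\<i> * herglotz (\<lambda>\<zeta>. enn2real (v \<zeta>)) z)" if "norm z < 1" for z
    by (rule prodinf_fE_eq_exp_herglotz[OF E int sums that])
qed simp

theorem theorem4p5:
  fixes E :: "nat \<Rightarrow> complex set"
  assumes meas: "\<And>n. circ_measurable (E n)"
  defines "v \<equiv> (\<lambda>\<zeta>. \<Sum>n. ennreal (pi * indicator (E n) \<zeta>))"
  shows "(summable (\<lambda>n. measure circ_m (E n)) \<longleftrightarrow> (\<integral>\<^sup>+ \<zeta>. v \<zeta> \<partial>circ_m) < \<infinity>)
       \<and> ((\<integral>\<^sup>+ \<zeta>. v \<zeta> \<partial>circ_m) < \<infinity> \<longleftrightarrow> prod_abs_loc_unif (\<lambda>n. fE (E n)))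
       \<and> (prod_abs_loc_unif (\<lambda>n. fE (E n)) \<longrightarrow>
            (Rplus (\<lambda>z. \<Prod>n. fE (E n) z) \<longleftrightarrow> LlogL (\<lambda>\<zeta>. enn2real (v \<zeta>))))"
proof -
  have E: "E n \<in> sets circ_m" for n
    using meas by (simp add: circ_measurable_def)
  have integrable_iff: "(\<integral>\<^sup>+ \<zeta>. v \<zeta> \<partial>circ_m) < \<infinity> \<longleftrightarrow> summable (\<lambda>n. measure circ_m (E n))"
    unfolding v_def by (rule circ.nn_integral_suminf_indicator_finite_iff[OF E pi_gt_zero])
  have Rplus_iff: "Rplus (\<lambda>z. \<Prod>n. fE (E n) z) \<longleftrightarrow> LlogL (\<lambda>\<zeta>. enn2real (v \<zeta>))"
    if "(\<integral>\<^sup>+ \<zeta>. v \<zeta> \<partial>circ_m) < \<infinity>"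
    using that unfolding v_def by (rule Rplus_prodinf_fE_iff[OF E])
  show ?thesis
    using integrable_iff prod_abs_loc_unif_fE_iff_summable[of E, OF E] Rplus_iff by blast
qed

end
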